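(* Let $w$ be an $n\times n$ partial permutation matrix. The generators of the ideal $I_w$ defining the matrix Schubert variety $X_w$ are the same as the generators of the ideal $I_{G(w),[n]\cup[n']}$ of the hidden variable Bayesian network for the DAG $G(w)$ with observed variables $[n]\cup[n']$. That is, $$I_w\cdot\mathbb{C}[\sigma_{ij}\mid i,j\in[n]\cup[n']]=I_{G(w),[n]\cup[n']}.$$
   Context: A partial permutation matrix is a $0/1$ matrix with at most one $1$ in each row and column. Let $B$ be the group of invertible upper triangular $n\times n$ complex matrices. The matrix Schubert variety is the orbit closure $X_w=\overline{B^TwB}\subseteq\mathbb{C}^{n\times n}$. Write $[n]=\{1,\dots,n\}$ and $[n']=\{1',\dots,n'\}$ (a disjoint copy of $[n]$). The coordinate ring of $\mathbb{C}^{n\times n}$ is identified with $\mathbb{C}[\sigma_{ij}\mid i\in[n],j\in[n']]$ (row index in $[n]$, column index in $[n']$), and $I_w$ is the vanishing ideal of $X_w$ in this ring. Let $S(w)=\{(i,j)\mid w_{ij}=1\}$. The DAG $G(w)$ has vertex set $[n]\cup[n']\cup S(w)$ and edges: $k\to l$ for all $k<l$ in $[n]$; $k'\to l'$ for all $k'<l'$ in $[n']$; $(i,j)\to k$ for all $(i,j)\in S(w)$ and $k\in[n]$ with $k\ge i$; and $(i,j)\to k'$ for all $(i,j)\in S(w)$ and $k'\in[n']$ with $k\ge j$. For a DAG $G$, a collider is a pair of edges $i\to k$, $j\to k$ with the same head, and $T(i,j)$ is the set of treks from $i$ to $j$: simple paths $P$ in (the underlying undirected graph of) $G$ from $i$ to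 $j$ containing no collider. Each trek goes from $i$ up to a topmost vertex $\mathrm{top}(P)$ and then down to $j$; $T(i,i)$ consists of the single empty trek, with top $i$. Let $\phi_G$ be the ring homomorphism from the polynomial ring in $\sigma_{ij}=\sigma_{ji}$, $i,j\in V(G)$, to $\mathbb{C}[a_i,\lambda_{ij}\mid i\in V(G),\ i\to j\in E(G)]$ given by $\sigma_{ij}\mapsto\sum_{P\in T(i,j)}a_{\mathrm{top}(P)}\prod_{k\to l\in P}\lambda_{kl}$. Set $I_G=\ker\phi_G$ and, for a set $O\subseteq V(G)$ of observed variables, $I_{G,O}=I_G\cap\mathbb{C}[\sigma_{ij}\mid i,j\in O]$. *)

theory Defs
  imports
    Complex_Main
    "HOL-Library.Poly_Mapping"
    "HOL-Library.Uprod"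
    "HOL-Algebra.Ideal"
    "HOL-Algebra.RingHom"
    "Graph_Theory.Digraph_Component"
    "Graph_Theory.Vertex_Walk"
    "Jordan_Normal_Form.Matrix"
begin

section \<open>Multivariate polynomial rings\<close>

type_synonym ('x, 'a) mpoly = "('x \<Rightarrow>\<^sub>0 nat) \<Rightarrow>\<^sub>0 'a"

definition mConst :: "'a \<Rightarrow> ('x, 'a::zero) mpoly" where
  "mConst c = Poly_Mapping.single 0 c"

definition mVar :: "'x \<Rightarrow> ('x, 'a::zero_neq_one) mpoly" where
  "mVar x = Poly_Mapping.single (Poly_Mapping.single x 1) 1"

definition mvars :: "('x, 'a::zero) mpoly \<Rightarrow> 'x set" where
  "mvars p = (\<Union>m\<in>Poly_Mapping.keys p. Poly_Mapping.keys m)"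

text \<open>The polynomial ring in the variables \<open>X\<close>, a subset of the type of all variables.\<close>

definition mpoly_ring :: "'x set \<Rightarrow> ('x, 'a::comm_ring_1) mpoly ring" where
  "mpoly_ring X =
     \<lparr>carrier = {p. mvars p \<subseteq> X}, monoid.mult = (*), one = 1, zero = 0, add = (+)\<rparr>"

text \<open>The homomorphism that is \<open>c\<close> on coefficients and sends each variable \<open>x\<close> to \<open>f x\<close>.\<close>

definition mpoly_eval ::
  "('a \<Rightarrow> 'b::comm_ring_1) \<Rightarrow> ('x \<Rightarrow> 'b) \<Rightarrow> ('x, 'a::zero) mpoly \<Rightarrow> 'b" where
  "mpoly_eval c f p =
    (\<Sum>m\<in>Poly_Mapping.keys p.
      c (Poly_Mapping.lookup p m) * (\<Prod>x\<in>Poly_Mapping.keys m. f x ^ Poly_Mapping.lookup m x))"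

lemma mvars_add: "mvars (p + q) \<subseteq> mvars p \<union> mvars q"
  using Poly_Mapping.keys_add[of p q] unfolding mvars_def by fastforce

lemma mvars_mult:
  "mvars (p * q :: ('x, 'a::comm_ring_1) mpoly) \<subseteq> mvars p \<union> mvars q"
proof
  fix x assume "x \<in> mvars (p * q)"
  then obtain m where m: "m \<in> Poly_Mapping.keys (p * q)" "x \<in> Poly_Mapping.keys m" unfolding mvars_def by blast
  then obtain a b where ab: "m = a + b" "a \<in> Poly_Mapping.keys p" "b \<in> Poly_Mapping.keys q"
    using Poly_Mapping.keys_mult[of p q] by blast
  then have "x \<in> Poly_Mapping.keys a \<union> Poly_Mapping.keys b" using m(2) Poly_Mapping.keys_add[of a b] by blast
  with ab show "x \<in> mvars p \<union> mvars q" unfolding mvars_def by blast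
qed

lemma cring_mpoly_ring: "cring (mpoly_ring X :: ('x, 'a::comm_ring_1) mpoly ring)"
proof (rule cringI)
  have closed_add: "mvars (p + q) \<subseteq> X" if "mvars p \<subseteq> X" "mvars q \<subseteq> X"
    for p q :: "('x, 'a) mpoly" using mvars_add[of p q] that by blast
  have closed_mult: "mvars (p * q) \<subseteq> X" if "mvars p \<subseteq> X" "mvars q \<subseteq> X"
    for p q :: "('x, 'a) mpoly" using mvars_mult[of p q] that by blast
  show "abelian_group (mpoly_ring X :: ('x, 'a) mpoly ring)"
  proof (rule abelian_groupI)
    fix p :: "('x, 'a) mpoly" assume "p \<in> carrier (mpoly_ring X)"
    then have "- p \<in> carrier (mpoly_ring X)"
      by (simp add: mpoly_ring_def mvars_def)
    then show "\<exists>q\<in>carrier (mpoly_ring X). q \<oplus>\<^bsub>mpoly_ring X\<^esub> p = \<zero>\<^bsub>mpoly_ring X\<^esub>"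
      by (intro bexI[of _ "- p"]) (simp_all add: mpoly_ring_def)
  qed (auto simp: mpoly_ring_def algebra_simps closed_add, auto simp: mvars_def)
  show "comm_monoid (mpoly_ring X :: ('x, 'a) mpoly ring)"
    by (rule comm_monoidI) (auto simp: mpoly_ring_def algebra_simps closed_mult, auto simp: mvars_def)
qed (auto simp: mpoly_ring_def algebra_simps)


section \<open>Matrix Schubert varieties\<close>

text \<open>Row and column indices run over \<open>{..<n}\<close> instead of \<open>{1..n}\<close> throughout.\<close>

definition partial_permutation_mat :: "nat \<Rightarrow> complex mat \<Rightarrow> bool" where
  "partial_permutation_mat n w \<longleftrightarrow>
     w \<in> carrier_mat n n \<and>
     (\<forall>i<n. \<forall>j<n. w $$ (i, j) = 0 \<or> w $$ (i, j) = 1) \<and>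
     (\<forall>i<n. \<forall>j<n. \<forall>l<n. w $$ (i, j) = 1 \<and> w $$ (i, l) = 1 \<longrightarrow> j = l) \<and>
     (\<forall>j<n. \<forall>i<n. \<forall>k<n. w $$ (i, j) = 1 \<and> w $$ (k, j) = 1 \<longrightarrow> i = k)"

definition borel_group :: "nat \<Rightarrow> complex mat set" where
  "borel_group n = {b \<in> carrier_mat n n. upper_triangular b \<and> invertible_mat b}"

definition coordinate_ring :: "nat \<Rightarrow> (nat \<times> nat, complex) mpoly ring" where
  "coordinate_ring n = mpoly_ring ({..<n} \<times> {..<n})"

definition vanishing_ideal :: "nat \<Rightarrow> complex mat set \<Rightarrow> (nat \<times> nat, complex) mpoly set" where
  "vanishing_ideal n S =
     {p \<in> carrier (coordinate_ring n). \<forall>M\<in>S. mpoly_eval id (($$) M) p = 0}"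

definition zero_locus :: "nat \<Rightarrow> (nat \<times> nat, complex) mpoly set \<Rightarrow> complex mat set" where
  "zero_locus n P = {M \<in> carrier_mat n n. \<forall>p\<in>P. mpoly_eval id (($$) M) p = 0}"

definition zariski_closure :: "nat \<Rightarrow> complex mat set \<Rightarrow> complex mat set" where
  "zariski_closure n S = zero_locus n (vanishing_ideal n S)"

definition matrix_schubert_variety :: "nat \<Rightarrow> complex mat \<Rightarrow> complex mat set" where
  "matrix_schubert_variety n w =
     zariski_closure n {transpose_mat b * w * c | b c. b \<in> borel_group n \<and> c \<in> borel_group n}"

definition schubert_ideal :: "nat \<Rightarrow> complex mat \<Rightarrow> (nat \<times> nat, complex) mpoly set" where
  "schubert_ideal n w = vanishing_ideal n (matrix_schubert_variety n w)"


section \<open>Hidden variable Gaussian Bayesian networks\<close>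

text \<open>
  A path is given by its list of vertices. The edges of \<open>G\<close> on a path of the underlying undirected
  graph keep their orientation in \<open>G\<close>; if \<open>G\<close> is acyclic, exactly one edge of \<open>G\<close> joins each two
  consecutive vertices.
\<close>

definition path_edges :: "'v pair_pre_digraph \<Rightarrow> 'v list \<Rightarrow> ('v \<times> 'v) set" where
  "path_edges G p = parcs G \<inter> (set (vwalk_arcs p) \<union> (set (vwalk_arcs p))\<inverse>)"

definition has_collider :: "('v \<times> 'v) set \<Rightarrow> bool" where
  "has_collider E \<longleftrightarrow> (\<exists>i j k. i \<noteq> j \<and> (i, k) \<in> E \<and> (j, k) \<in> E)"

definition treks :: "'v pair_pre_digraph \<Rightarrow> 'v \<Rightarrow> 'v \<Rightarrow> 'v list set" where
  "treks G i j =
     {p. vpath p (mk_symmetric G) \<and> hd p = i \<and> last p = j \<and> \<not> has_collider (path_edges G p)}"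

text \<open>The topmost vertex of a trek is its only vertex that no edge of the trek enters.\<close>

definition trek_top :: "'v pair_pre_digraph \<Rightarrow> 'v list \<Rightarrow> 'v" where
  "trek_top G p = (THE v. v \<in> set p \<and> (\<forall>e\<in>path_edges G p. snd e \<noteq> v))"

datatype 'v param = Avar 'v | Lamvar 'v 'v

definition trek_monomial :: "'v pair_pre_digraph \<Rightarrow> 'v list \<Rightarrow> ('v param, complex) mpoly" where
  "trek_monomial G p = mVar (Avar (trek_top G p)) * (\<Prod>(k, l)\<in>path_edges G p. mVar (Lamvar k l))"

lemma vwalk_arcs_snoc:
  "p \<noteq> [] \<Longrightarrow> vwalk_arcs (p @ [x]) = vwalk_arcs p @ [(last p, x)]"
  by (induction p rule: vwalk_arcs.induct) auto

lemma set_vwalk_arcs_rev: "set (vwalk_arcs (rev p)) = (set (vwalk_arcs p))\<inverse>"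
proof (induction p rule: vwalk_arcs.induct)
  case (3 x y xs)
  then show ?case using vwalk_arcs_snoc[of "rev (y # xs)" x] by (auto simp: last_rev)
qed auto

lemma path_edges_rev: "path_edges G (rev p) = path_edges G p"
  unfolding path_edges_def set_vwalk_arcs_rev by auto

lemma trek_monomial_rev: "trek_monomial G (rev p) = trek_monomial G p"
  by (simp add: trek_monomial_def trek_top_def path_edges_rev)

lemma rev_in_treks:
  assumes "p \<in> treks G i j"
  shows "rev p \<in> treks G j i"
proof -
  have sym: "symmetric (with_proj (mk_symmetric (with_proj G)))"
    by (rule symmetric_mk_symmetric)
  have "vpath (rev p) (mk_symmetric G)"
    using assms sym
    by (auto simp: treks_def vpath_def vwalk_def set_vwalk_arcs_rev symmetric_def sym_conv_converse_eq)
  then show ?thesis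
    using assms by (auto simp: treks_def path_edges_rev hd_rev last_rev vpath_def)
qed

text \<open>Reversal of treks makes the trek sum a function of the unordered pair of endpoints.\<close>

lift_definition trek_sum :: "'v pair_pre_digraph \<Rightarrow> ('v, ('v param, complex) mpoly) commute"
  is "\<lambda>G i j. \<Sum>p\<in>treks G i j. trek_monomial G p"
proof -
  fix G :: "'v pair_pre_digraph" and i j
  show "(\<Sum>p\<in>treks G i j. trek_monomial G p) = (\<Sum>p\<in>treks G j i. trek_monomial G p)"
    by (rule sum.reindex_bij_witness[of _ rev rev]) (auto simp: rev_in_treks trek_monomial_rev)
qed

text \<open>The variable \<open>\<sigma>\<^sub>i\<^sub>j = \<sigma>\<^sub>j\<^sub>i\<close> is indexed by the unordered pair \<open>Upair i j\<close>.\<close>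

definition sigma_ring :: "'v set \<Rightarrow> ('v uprod, complex) mpoly ring" where
  "sigma_ring V = mpoly_ring {Upair i j | i j. i \<in> V \<and> j \<in> V}"

definition param_ring :: "'v pair_pre_digraph \<Rightarrow> ('v param, complex) mpoly ring" where
  "param_ring G = mpoly_ring ({Avar i | i. i \<in> pverts G} \<union> {Lamvar i j | i j. (i, j) \<in> parcs G})"

definition trek_hom ::
  "'v pair_pre_digraph \<Rightarrow> ('v uprod, complex) mpoly \<Rightarrow> ('v param, complex) mpoly" where
  "trek_hom G = mpoly_eval mConst (case_uprod (trek_sum G))"

definition network_ideal :: "'v pair_pre_digraph \<Rightarrow> ('v uprod, complex) mpoly set" where
  "network_ideal G = a_kernel (sigma_ring (pverts G)) (param_ring G) (trek_hom G)"

definition hidden_network_ideal ::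
  "'v pair_pre_digraph \<Rightarrow> 'v set \<Rightarrow> ('v uprod, complex) mpoly set" where
  "hidden_network_ideal G Obs = network_ideal G \<inter> carrier (sigma_ring Obs)"


section \<open>The network of a partial permutation matrix\<close>

text \<open>\<open>Row k\<close> and \<open>Col k\<close> stand for \<open>k \<in> [n]\<close> and \<open>k' \<in> [n']\<close>; \<open>Entry i j\<close> stands for \<open>(i, j) \<in> S(w)\<close>.\<close>

datatype vertex = Row nat | Col nat | Entry nat nat

definition observed :: "nat \<Rightarrow> vertex set" where
  "observed n = Row ` {..<n} \<union> Col ` {..<n}"

definition support :: "nat \<Rightarrow> complex mat \<Rightarrow> (nat \<times> nat) set" where
  "support n w = {(i, j). i < n \<and> j < n \<and> w $$ (i, j) = 1}"

definition schubert_dag :: "nat \<Rightarrow> complex mat \<Rightarrow> vertex pair_pre_digraph" where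
  "schubert_dag n w = \<lparr>
     pverts = observed n \<union> {Entry i j | i j. (i, j) \<in> support n w},
     parcs = {(Row k, Row l) | k l. k < l \<and> l < n}
           \<union> {(Col k, Col l) | k l. k < l \<and> l < n}
           \<union> {(Entry i j, Row k) | i j k. (i, j) \<in> support n w \<and> i \<le> k \<and> k < n}
           \<union> {(Entry i j, Col k) | i j k. (i, j) \<in> support n w \<and> j \<le> k \<and> k < n}\<rparr>"

lemma acyclic_schubert_dag: "acyclic (parcs (schubert_dag n w))"
proof -
  let ?h = "case_vertex Suc Suc (\<lambda>_ _. 0)"
  have "parcs (schubert_dag n w) \<subseteq> measure ?h"
    by (auto simp: schubert_dag_def)
  then show ?thesis
    by (meson wf_measure wf_subset wf_acyclic)
qed

text \<open>The inclusion of the coordinate ring of the matrix space sends the \<open>(i, j)\<close> entry to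
  \<open>\<sigma>\<close> at the row \<open>i\<close> and the column \<open>j'\<close>.\<close>

definition coordinate_embedding ::
  "(nat \<times> nat, complex) mpoly \<Rightarrow> (vertex uprod, complex) mpoly" where
  "coordinate_embedding = mpoly_eval mConst (\<lambda>(i, j). mVar (Upair (Row i) (Col j)))"

end

theory Submission
  imports Defs "Jordan_Normal_Form.Determinant"
begin

text \<open>
  Every trek from a row to a column has an entry \<open>e = (k, l)\<close> of \<open>w\<close> as its top, so the row-column block
  of the covariance matrix is \<open>\<Sum>\<^sub>e P\<^sub>e Q\<^sub>e\<^sup>T / a\<^sub>e\<close>, where \<open>P\<^sub>e\<close> and \<open>Q\<^sub>e\<close> are the covariances of \<open>e\<close> with the rows
  and the columns. They vanish before \<open>k\<close> and \<open>l\<close> respectively, so for nonzero parameters the block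
  has the form \<open>b\<^sup>T w c\<close> with \<open>b\<close> and \<open>c\<close> in the Borel group; since a polynomial vanishing at all nonzero
  arguments is zero, \<open>I\<^sub>w\<close> lies in the kernel.

  Conversely, for fixed \<open>b\<close> and \<open>c\<close> the row-row and column-column blocks can be prescribed freely, as
  long as their diagonals are large enough: the edge weights solve diagonally dominant linear systems.
  So the coefficients of an element of the kernel, read as a polynomial in the row-row and
  column-column variables, vanish at \<open>b\<^sup>T w c\<close> and therefore belong to \<open>I\<^sub>w\<close>.
\<close>

section \<open>Evaluation of polynomials\<close>

text \<open>The exponent part of \<open>mpoly_eval\<close>, split off because it carries sums of
  exponents to products.\<close>

definition monomial_eval :: "('x \<Rightarrow> 'b::comm_ring_1) \<Rightarrow> ('x \<Rightarrow>\<^sub>0 nat) \<Rightarrow> 'b" where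
  "monomial_eval f m = (\<Prod>x\<in>Poly_Mapping.keys m. f x ^ Poly_Mapping.lookup m x)"

lemma monomial_eval_superset:
  assumes "finite X" "Poly_Mapping.keys m \<subseteq> X"
  shows "monomial_eval f m = (\<Prod>x\<in>X. f x ^ Poly_Mapping.lookup m x)"
  unfolding monomial_eval_def
  by (rule prod.mono_neutral_left) (use assms in \<open>auto simp: in_keys_iff\<close>)

lemma monomial_eval_0 [simp]: "monomial_eval f 0 = 1"
  by (simp add: monomial_eval_def)

lemma monomial_eval_single [simp]: "monomial_eval f (Poly_Mapping.single x k) = f x ^ k"
  by (cases "k = 0") (simp_all add: monomial_eval_def)

lemma monomial_eval_add: "monomial_eval f (m + k) = monomial_eval f m * monomial_eval f k"
proof -
  let ?X = "Poly_Mapping.keys m \<union> Poly_Mapping.keys k"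
  have "Poly_Mapping.keys (m + k) \<subseteq> ?X" by (rule Poly_Mapping.keys_add)
  then show ?thesis
    by (simp add: monomial_eval_superset[of ?X] lookup_add power_add prod.distrib)
qed

lemma mpoly_eval_conv: "mpoly_eval c f p =
  (\<Sum>m\<in>Poly_Mapping.keys p. c (Poly_Mapping.lookup p m) * monomial_eval f m)"
  by (simp add: mpoly_eval_def monomial_eval_def)

text \<open>Enlarging the index set only adds terms with coefficient \<open>c 0 = 0\<close>, so
  several polynomials can be summed over one common set of monomials.\<close>

lemma mpoly_eval_superset:
  assumes "c 0 = 0" "finite K" "Poly_Mapping.keys p \<subseteq> K"
  shows "mpoly_eval c f p = (\<Sum>m\<in>K. c (Poly_Mapping.lookup p m) * monomial_eval f m)"
  unfolding mpoly_eval_conv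
  by (rule sum.mono_neutral_left) (use assms in \<open>auto simp: in_keys_iff\<close>)

lemma mpoly_eval_single:
  assumes "c 0 = 0"
  shows "mpoly_eval c f (Poly_Mapping.single m a) = c a * monomial_eval f m"
  using assms by (cases "a = 0") (simp_all add: mpoly_eval_conv)

lemma mpoly_eval_cong:
  assumes "\<And>x. x \<in> mvars p \<Longrightarrow> f x = g x"
  shows "mpoly_eval c f p = mpoly_eval c g p"
proof -
  have "f x = g x" if "m \<in> Poly_Mapping.keys p" "x \<in> Poly_Mapping.keys m" for m x
    using assms that by (auto simp: mvars_def)
  then show ?thesis
    unfolding mpoly_eval_def by (intro sum.cong refl arg_cong2[where f = "(*)"] prod.cong) auto
qed

lemma poly_mapping_sum_single:
  "p = (\<Sum>m\<in>Poly_Mapping.keys p. Poly_Mapping.single m (Poly_Mapping.lookup p m))"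
  by (rule poly_mapping_eqI) (simp add: lookup_sum lookup_single when_def in_keys_iff)

text \<open>Additivity comes from a common set of monomials, multiplicativity from expanding both
  factors into monomials.\<close>

lemma comm_ring_hom_mpoly_eval:
  fixes c :: "'a::comm_ring_1 \<Rightarrow> 'b::comm_ring_1" and f :: "'x \<Rightarrow> 'b"
  assumes "comm_ring_hom c"
  shows "comm_ring_hom (mpoly_eval c f)"
proof -
  interpret c: comm_ring_hom c by fact
  have single: "mpoly_eval c f (Poly_Mapping.single m a) = c a * monomial_eval f m" for m a
    by (rule mpoly_eval_single) simp
  have add: "mpoly_eval c f (p + q) = mpoly_eval c f p + mpoly_eval c f q" for p q
  proof -
    let ?K = "Poly_Mapping.keys p \<union> Poly_Mapping.keys q"
    have "Poly_Mapping.keys (p + q) \<subseteq> ?K" by (rule Poly_Mapping.keys_add)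
    then show ?thesis
      by (simp add: mpoly_eval_superset[of c ?K] lookup_add c.hom_add sum.distrib algebra_simps)
  qed
  have zero: "mpoly_eval c f 0 = 0" by (simp add: mpoly_eval_def)
  have sum: "mpoly_eval c f (sum h K) = (\<Sum>i\<in>K. mpoly_eval c f (h i))"
    for h :: "('x \<Rightarrow>\<^sub>0 nat) \<Rightarrow> ('x, 'a) mpoly" and K
    by (induction K rule: infinite_finite_induct) (simp_all add: add zero)
  have mult: "mpoly_eval c f (p * q) = mpoly_eval c f p * mpoly_eval c f q" for p q
  proof -
    have "p * q = (\<Sum>m\<in>Poly_Mapping.keys p. Poly_Mapping.single m (Poly_Mapping.lookup p m)) *
      (\<Sum>m\<in>Poly_Mapping.keys q. Poly_Mapping.single m (Poly_Mapping.lookup q m))"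
      by (simp flip: poly_mapping_sum_single)
    also have "\<dots> = (\<Sum>m\<in>Poly_Mapping.keys p. \<Sum>k\<in>Poly_Mapping.keys q.
      Poly_Mapping.single (m + k) (Poly_Mapping.lookup p m * Poly_Mapping.lookup q k))"
      by (simp add: sum_product mult_single)
    also have "mpoly_eval c f \<dots> = (\<Sum>m\<in>Poly_Mapping.keys p. \<Sum>k\<in>Poly_Mapping.keys q.
      (c (Poly_Mapping.lookup p m) * monomial_eval f m) *
      (c (Poly_Mapping.lookup q k) * monomial_eval f k))"
      by (simp add: sum single c.hom_mult monomial_eval_add algebra_simps)
    also have "\<dots> = mpoly_eval c f p * mpoly_eval c f q"
      by (simp add: mpoly_eval_conv sum_product)
    finally show ?thesis .
  qed
  show ?thesis
  proof
    show "mpoly_eval c f 1 = 1"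
      using single[of 0 1] by simp
  qed (fact add mult zero)+
qed

lemma comm_ring_hom_id: "comm_ring_hom id"
  by unfold_locales auto

lemma comm_ring_hom_mConst: "comm_ring_hom mConst"
  by unfold_locales (simp_all add: mConst_def single_add mult_single)

lemma mpoly_eval_mVar:
  assumes "comm_ring_hom c"
  shows "mpoly_eval c f (mVar x) = f x"
proof -
  interpret c: comm_ring_hom c by fact
  show ?thesis by (simp add: mVar_def mpoly_eval_single)
qed

lemma mpoly_eval_mConst: "c 0 = 0 \<Longrightarrow> mpoly_eval c f (mConst a) = c a"
  unfolding mConst_def by (simp add: mpoly_eval_single)

lemma hom_mpoly_eval:
  assumes "comm_ring_hom h"
  shows "h (mpoly_eval c f p) = mpoly_eval (h \<circ> c) (h \<circ> f) p"
proof -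
  interpret h: comm_ring_hom h by fact
  show ?thesis
    by (simp add: mpoly_eval_def h.hom_sum h.hom_mult h.hom_prod h.hom_power)
qed

lemma mpoly_eval_mpoly_eval:
  assumes "comm_ring_hom c"
  shows "mpoly_eval c f (mpoly_eval mConst g p) = mpoly_eval c (\<lambda>x. mpoly_eval c f (g x)) p"
proof -
  interpret c: comm_ring_hom c by fact
  show ?thesis
    by (simp add: hom_mpoly_eval[OF comm_ring_hom_mpoly_eval[OF assms]] comp_def mpoly_eval_mConst)
qed

lemma monomial_eval_mVar:
  "monomial_eval mVar m = (Poly_Mapping.single m 1 :: ('x, 'a::comm_ring_1) mpoly)"
proof -
  have pow: "(mVar x :: ('x, 'a) mpoly) ^ k = Poly_Mapping.single (Poly_Mapping.single x k) 1" for x k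
    by (induction k) (simp_all add: mVar_def mult_single single_add[symmetric])
  have "(\<Prod>x\<in>X. Poly_Mapping.single (g x) (1::'a)) = Poly_Mapping.single (sum g X) 1"
    for g :: "'x \<Rightarrow> ('x \<Rightarrow>\<^sub>0 nat)" and X
    by (induction X rule: infinite_finite_induct) (simp_all add: mult_single)
  then show ?thesis
    by (simp add: monomial_eval_def pow poly_mapping_sum_single[symmetric])
qed

lemma mpoly_eval_mConst_mVar: "mpoly_eval mConst mVar p = (p :: ('x, 'a::comm_ring_1) mpoly)"
  by (subst (2) poly_mapping_sum_single)
    (simp add: mpoly_eval_conv monomial_eval_mVar mConst_def mult_single)

section \<open>Variables of sums, products and substitutions\<close>

lemma mvars_sum: "mvars (sum h K) \<subseteq> (\<Union>i\<in>K. mvars (h i))"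
proof (induction K rule: infinite_finite_induct)
  case (insert a K)
  then show ?case using mvars_add[of "h a" "sum h K"] by auto
qed (simp_all add: mvars_def)

lemma mvars_prod:
  "mvars (prod h K) \<subseteq> (\<Union>i\<in>K. mvars (h i :: ('x, 'a::comm_ring_1) mpoly))"
proof (induction K rule: infinite_finite_induct)
  case (insert a K)
  then show ?case using mvars_mult[of "h a" "prod h K"] by auto
qed (simp_all add: mvars_def)

lemma mvars_power: "mvars (p ^ k) \<subseteq> mvars (p :: ('x, 'a::comm_ring_1) mpoly)"
proof (induction k)
  case (Suc k)
  then show ?case using mvars_mult[of p "p ^ k"] by auto
qed (simp_all add: mvars_def)

lemma mvars_mConst: "mvars (mConst c) = {}"
  by (auto simp: mvars_def mConst_def)

lemma mvars_mVar: "mvars (mVar x :: ('x, 'a::comm_ring_1) mpoly) = {x}"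
  by (auto simp: mvars_def mVar_def)

lemma mvars_mpoly_eval:
  "mvars (mpoly_eval mConst f p :: ('y, 'a::comm_ring_1) mpoly) \<subseteq> (\<Union>x\<in>mvars p. mvars (f x))"
proof -
  have "mvars (mConst (Poly_Mapping.lookup p m) *
      (\<Prod>x\<in>Poly_Mapping.keys m. f x ^ Poly_Mapping.lookup m x)) \<subseteq> (\<Union>x\<in>mvars p. mvars (f x))"
    if "m \<in> Poly_Mapping.keys p" for m
  proof -
    have "mvars (\<Prod>x\<in>Poly_Mapping.keys m. f x ^ Poly_Mapping.lookup m x)
        \<subseteq> (\<Union>x\<in>Poly_Mapping.keys m. mvars (f x))"
      using mvars_prod mvars_power by (fastforce dest!: subsetD)
    with that show ?thesis
      by (intro order.trans[OF mvars_mult]) (auto simp: mvars_mConst mvars_def[of p])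
  qed
  then show ?thesis
    unfolding mpoly_eval_def by (intro order.trans[OF mvars_sum]) blast
qed

section \<open>Polynomials vanishing on products of infinite sets\<close>

text \<open>Restriction to \<open>X\<close> and to its complement factors a monomial; polynomials
  are regrouped by the second factor.\<close>

lift_definition monomial_restrict :: "'x set \<Rightarrow> ('x \<Rightarrow>\<^sub>0 nat) \<Rightarrow> ('x \<Rightarrow>\<^sub>0 nat)" is
  "\<lambda>X m x. if x \<in> X then m x else 0"
  by (rule finite_subset) auto

lemma monomial_restrict_split: "monomial_restrict X m + monomial_restrict (- X) m = m"
  by (rule poly_mapping_eqI) (simp add: lookup_add monomial_restrict.rep_eq)

lemma keys_monomial_restrict: "Poly_Mapping.keys (monomial_restrict X m) = Poly_Mapping.keys m \<inter> X"
  by (auto simp: in_keys_iff monomial_restrict.rep_eq split: if_splits)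

text \<open>The coefficient of \<open>\<mu>\<close> when \<open>p\<close> is read as a polynomial in the variables outside \<open>X\<close> with
  coefficients in the polynomials in the variables \<open>X\<close>.\<close>

definition partial_coeff :: "'x set \<Rightarrow> ('x, 'a::comm_ring_1) mpoly \<Rightarrow> ('x \<Rightarrow>\<^sub>0 nat) \<Rightarrow> ('x, 'a) mpoly" where
  "partial_coeff X p \<mu> = (\<Sum>m\<in>{m \<in> Poly_Mapping.keys p. monomial_restrict (- X) m = \<mu>}.
     Poly_Mapping.single (monomial_restrict X m) (Poly_Mapping.lookup p m))"

text \<open>Sort the monomials of \<open>p\<close> by their part outside \<open>X\<close>.\<close>

lemma partial_coeff_expansion:
  "p = (\<Sum>\<mu>\<in>monomial_restrict (- X) ` Poly_Mapping.keys p.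
    partial_coeff X p \<mu> * Poly_Mapping.single \<mu> 1)"
proof -
  have "(\<Sum>\<mu>\<in>monomial_restrict (- X) ` Poly_Mapping.keys p.
      partial_coeff X p \<mu> * Poly_Mapping.single \<mu> 1) =
    (\<Sum>\<mu>\<in>monomial_restrict (- X) ` Poly_Mapping.keys p.
      \<Sum>m\<in>{m \<in> Poly_Mapping.keys p. monomial_restrict (- X) m = \<mu>}.
        Poly_Mapping.single m (Poly_Mapping.lookup p m))"
    unfolding partial_coeff_def sum_distrib_right mult_single
    using monomial_restrict_split by (intro sum.cong) (auto intro!: arg_cong2[where f = Poly_Mapping.single])
  also have "\<dots> = p"
    by (subst sum.image_gen[symmetric]) (simp_all flip: poly_mapping_sum_single)
  finally show ?thesis by simp
qed

lemma mvars_partial_coeff: "mvars (partial_coeff X p \<mu>) \<subseteq> mvars p \<inter> X"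
proof -
  have "mvars (Poly_Mapping.single (monomial_restrict X m) (Poly_Mapping.lookup p m)) \<subseteq> mvars p \<inter> X"
    if "m \<in> Poly_Mapping.keys p" for m
    using that by (auto simp: mvars_def keys_monomial_restrict)
  then show ?thesis
    unfolding partial_coeff_def by (intro order.trans[OF mvars_sum]) auto
qed

lemma monomial_eval_cong:
  "(\<And>x. x \<in> Poly_Mapping.keys m \<Longrightarrow> f x = g x) \<Longrightarrow> monomial_eval f m = monomial_eval g m"
  by (simp add: monomial_eval_def)

text \<open>The coefficients only involve variables in \<open>X\<close>, where \<open>f\<close> and
  \<open>g\<close> agree. So \<open>f\<close> may vary outside \<open>X\<close> while the
  coefficient values stay fixed.\<close>

lemma mpoly_eval_partial:
  fixes p :: "('x, 'a::comm_ring_1) mpoly"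
  assumes "\<And>x. x \<in> X \<Longrightarrow> f x = g x"
  shows "mpoly_eval id f p = (\<Sum>\<mu>\<in>monomial_restrict (- X) ` Poly_Mapping.keys p.
    mpoly_eval id g (partial_coeff X p \<mu>) * monomial_eval f \<mu>)"
proof -
  interpret e: comm_ring_hom "mpoly_eval id f :: ('x, 'a) mpoly \<Rightarrow> 'a"
    by (intro comm_ring_hom_mpoly_eval comm_ring_hom_id)
  have "mpoly_eval id f (partial_coeff X p \<mu>) = mpoly_eval id g (partial_coeff X p \<mu>)" for \<mu>
    by (rule mpoly_eval_cong, rule assms) (use mvars_partial_coeff[of X p \<mu>] in auto)
  note coeff = this
  have "mpoly_eval id f p = mpoly_eval id f (\<Sum>\<mu>\<in>monomial_restrict (- X) ` Poly_Mapping.keys p.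
    partial_coeff X p \<mu> * Poly_Mapping.single \<mu> 1)"
    using partial_coeff_expansion[of p X] by (rule arg_cong)
  also have "\<dots> = (\<Sum>\<mu>\<in>monomial_restrict (- X) ` Poly_Mapping.keys p.
    mpoly_eval id f (partial_coeff X p \<mu>) * monomial_eval f \<mu>)"
    unfolding e.hom_sum e.hom_mult by (simp add: mpoly_eval_single)
  finally show ?thesis unfolding coeff .
qed

text \<open>Induction on a finite set containing the variables. Once the variables in
  \<open>X\<close> have values, \<open>p\<close> is a univariate polynomial in the new variable
  \<open>x\<close> with infinitely many roots. Hence its coefficients vanish at all these values,
  and the induction hypothesis applies to them.\<close>

lemma mpoly_eq_0_if_vanishing:
  fixes p :: "('x, 'a::idom) mpoly"
  assumes "\<And>x. infinite (A x)" and "\<And>f. (\<And>x. f x \<in> A x) \<Longrightarrow> mpoly_eval id f p = 0"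
  shows "p = 0"
proof -
  have "finite X \<Longrightarrow> mvars p \<subseteq> X \<Longrightarrow> (\<And>f. (\<And>x. f x \<in> A x) \<Longrightarrow> mpoly_eval id f p = 0) \<Longrightarrow> p = 0"
    for X and p :: "('x, 'a) mpoly"
  proof (induction X arbitrary: p rule: finite_induct)
    case empty
    have keys: "Poly_Mapping.keys p \<subseteq> {0}"
      using empty.prems(1) by (auto simp: mvars_def)
    have "\<forall>x. \<exists>y. y \<in> A x"
      using assms(1) infinite_imp_nonempty by blast
    then obtain f where "\<And>x. f x \<in> A x"
      by metis
    then have "mpoly_eval id f p = 0" by (rule empty.prems(2))
    then have "Poly_Mapping.lookup p 0 = 0"
      by (simp add: mpoly_eval_superset[OF _ _ keys])
    with keys show ?case
      by (metis insertE in_keys_iff keys_eq_empty subset_iff subset_singletonD singletonI)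
  next
    case (insert x X)
    let ?M = "monomial_restrict (- X) ` Poly_Mapping.keys p"
    \<comment> \<open>All variables of \<open>p\<close> other than \<open>x\<close> lie in
      \<open>X\<close>, so the outer monomials are powers of \<open>x\<close>.\<close>
    have mono: "\<exists>k. \<mu> = Poly_Mapping.single x k" if "\<mu> \<in> ?M" for \<mu>
    proof -
      have "Poly_Mapping.keys \<mu> \<subseteq> {x}"
        using that insert.prems(1) unfolding mvars_def by (fastforce simp: keys_monomial_restrict)
      then have "\<mu> = Poly_Mapping.single x (Poly_Mapping.lookup \<mu> x)"
        by (intro poly_mapping_eqI) (auto simp: lookup_single when_def in_keys_iff)
      then show ?thesis by blast
    qed
    have "partial_coeff X p \<mu> = 0" if \<mu>: "\<mu> \<in> ?M" for \<mu>
    proof (rule insert.IH)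
      show "mvars (partial_coeff X p \<mu>) \<subseteq> X"
        using mvars_partial_coeff[of X p \<mu>] by auto
      fix g assume g: "\<And>y. g y \<in> A y"
      \<comment> \<open>\<open>p\<close> as a univariate polynomial in \<open>x\<close>, after the
        variables in \<open>X\<close> have received the values \<open>g\<close>.\<close>
      define q where "q = (\<Sum>\<nu>\<in>?M. monom (mpoly_eval id g (partial_coeff X p \<nu>)) (Poly_Mapping.lookup \<nu> x))"
      have "poly q t = 0" if "t \<in> A x" for t
      proof -
        have "0 = mpoly_eval id (g(x := t)) p"
          using g that by (intro insert.prems(2)[symmetric]) simp
        also have "\<dots> = (\<Sum>\<nu>\<in>?M. mpoly_eval id g (partial_coeff X p \<nu>) * monomial_eval (g(x := t)) \<nu>)"
          by (rule mpoly_eval_partial) (use insert.hyps in auto)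
        also have "\<dots> = (\<Sum>\<nu>\<in>?M. mpoly_eval id g (partial_coeff X p \<nu>) * t ^ Poly_Mapping.lookup \<nu> x)"
        proof (intro sum.cong refl arg_cong2[where f = "(*)"])
          fix \<nu> assume "\<nu> \<in> ?M"
          then obtain k where "\<nu> = Poly_Mapping.single x k" using mono by blast
          then show "monomial_eval (g(x := t)) \<nu> = t ^ Poly_Mapping.lookup \<nu> x" by simp
        qed
        also have "\<dots> = poly q t"
          by (simp add: q_def poly_sum poly_monom)
        finally show ?thesis by simp
      qed
      then have "A x \<subseteq> {t. poly q t = 0}" by auto
      with assms(1)[of x] have "q = 0"
        using poly_roots_finite finite_subset by blast
      then have "0 = coeff q (Poly_Mapping.lookup \<mu> x)" by simp
      \<comment> \<open>Different outer monomials are different powers of \<open>x\<close>, so this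
        coefficient of \<open>q\<close> comes from \<mu> alone.\<close>
      also have "\<dots> = (\<Sum>\<nu>\<in>?M. if \<nu> = \<mu> then mpoly_eval id g (partial_coeff X p \<nu>) else 0)"
        unfolding q_def coeff_sum coeff_monom
      proof (intro sum.cong refl if_cong)
        fix \<nu> assume "\<nu> \<in> ?M"
        then show "(Poly_Mapping.lookup \<nu> x = Poly_Mapping.lookup \<mu> x) = (\<nu> = \<mu>)"
          using mono[of \<nu>] mono[OF \<mu>] by auto
      qed
      also have "\<dots> = mpoly_eval id g (partial_coeff X p \<mu>)"
        using \<mu> by simp
      finally show "mpoly_eval id g (partial_coeff X p \<mu>) = 0" by simp
    qed
    then have "(\<Sum>\<mu>\<in>?M. partial_coeff X p \<mu> * Poly_Mapping.single \<mu> 1) = 0"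
      by (intro sum.neutral) simp
    with partial_coeff_expansion[of p X] show ?case
      by (rule trans)
  qed
  moreover have "finite (mvars p)"
    by (simp add: mvars_def)
  ultimately show ?thesis using assms(2) by blast
qed

text \<open>With the values \<open>g\<close> on \<open>X\<close> fixed, the evaluated coefficients
  are the coefficients of a polynomial \<open>q\<close> in the outer variables. It vanishes on a
  product of infinite sets, so it is zero.\<close>

lemma partial_coeff_vanishing:
  fixes p :: "('x, 'a::idom) mpoly"
  assumes "\<And>x. infinite (A x)"
    and "\<And>f. (\<And>x. x \<in> X \<Longrightarrow> f x = g x) \<Longrightarrow> (\<And>x. x \<notin> X \<Longrightarrow> f x \<in> A x) \<Longrightarrow> mpoly_eval id f p = 0"
    and \<mu>: "\<mu> \<in> monomial_restrict (- X) ` Poly_Mapping.keys p"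
  shows "mpoly_eval id g (partial_coeff X p \<mu>) = 0"
proof -
  let ?M = "monomial_restrict (- X) ` Poly_Mapping.keys p"
  let ?h = "\<lambda>\<nu>. mpoly_eval id g (partial_coeff X p \<nu>)"
  define q where "q = (\<Sum>\<nu>\<in>?M. Poly_Mapping.single \<nu> (?h \<nu>))"
  have "q = 0"
  proof (rule mpoly_eq_0_if_vanishing[of A])
    fix f assume f: "\<And>x. f x \<in> A x"
    interpret e: comm_ring_hom "mpoly_eval id f :: ('x, 'a) mpoly \<Rightarrow> 'a"
      by (intro comm_ring_hom_mpoly_eval comm_ring_hom_id)
    \<comment> \<open>Only outer variables occur in \<open>q\<close>, so \<open>f\<close> may be
      overwritten by \<open>g\<close> on \<open>X\<close>, which turns the sum into a value of
      \<open>p\<close>.\<close>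
    let ?f = "\<lambda>x. if x \<in> X then g x else f x"
    have "mpoly_eval id f q = (\<Sum>\<nu>\<in>?M. ?h \<nu> * monomial_eval f \<nu>)"
      by (simp add: q_def e.hom_sum mpoly_eval_single)
    also have "\<dots> = (\<Sum>\<nu>\<in>?M. ?h \<nu> * monomial_eval ?f \<nu>)"
      by (intro sum.cong refl arg_cong2[where f = "(*)"] monomial_eval_cong)
        (auto simp: keys_monomial_restrict)
    also have "\<dots> = mpoly_eval id ?f p"
      by (rule mpoly_eval_partial[symmetric]) simp
    also have "\<dots> = 0"
      by (rule assms(2)) (use f in auto)
    finally show "mpoly_eval id f q = 0" .
  qed fact
  then have "0 = Poly_Mapping.lookup q \<mu>" by simp
  also have "\<dots> = ?h \<mu>"
    using \<mu> by (simp add: q_def lookup_sum lookup_single when_def)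
  finally show ?thesis by simp
qed

section \<open>The trek rule\<close>

text \<open>The rank witnesses acyclicity and tells at which end a trek can be shortened: the one of
  larger rank.\<close>

locale ranked_dag =
  fixes G :: "'v pair_pre_digraph" and rank :: "'v \<Rightarrow> nat"
  assumes finite_verts: "finite (pverts G)"
    and arcs_in_verts: "parcs G \<subseteq> pverts G \<times> pverts G"
    and rank_less: "(x, y) \<in> parcs G \<Longrightarrow> rank x < rank y"
begin

section \<open>Treks as lists of vertices\<close>

lemma treks_iff:
  "p \<in> treks G i j \<longleftrightarrow>
    p \<noteq> [] \<and> set p \<subseteq> pverts G \<and> set (vwalk_arcs p) \<subseteq> parcs G \<union> (parcs G)\<inverse> \<and> distinct p \<and>
    hd p = i \<and> last p = j \<and> \<not> has_collider (path_edges G p)"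
proof -
  have "parcs (mk_symmetric G) = parcs G \<union> (parcs G)\<inverse>"
    by (auto simp: mk_symmetric_def)
  then show ?thesis
    by (auto simp: treks_def vpath_def vwalk_def mk_symmetric_def)
qed

lemma finite_treks: "finite (treks G i j)"
proof (rule finite_subset)
  show "treks G i j \<subseteq> {p. set p \<subseteq> pverts G \<and> distinct p}"
    by (auto simp: treks_iff)
  show "finite {p. set p \<subseteq> pverts G \<and> distinct p}"
    by (rule finite_subset_distinct[OF finite_verts])
qed

lemma path_edges_mono:
  "set (vwalk_arcs p) \<subseteq> set (vwalk_arcs q) \<Longrightarrow> path_edges G p \<subseteq> path_edges G q"
  by (auto simp: path_edges_def)

lemma has_collider_mono: "has_collider E \<Longrightarrow> E \<subseteq> F \<Longrightarrow> has_collider F"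
  unfolding has_collider_def by blast

lemma finite_path_edges: "finite (path_edges G p)"
  by (auto simp: path_edges_def)

lemma path_edges_in_set:
  assumes "(x, y) \<in> path_edges G p"
  shows "x \<in> set p" "y \<in> set p"
proof -
  have "x \<in> set p \<and> y \<in> set p" if "(x, y) \<in> set (vwalk_arcs p)" for x y
    using that by (induction p rule: vwalk_arcs.induct) auto
  then show "x \<in> set p" "y \<in> set p"
    using assms by (auto simp: path_edges_def)
qed

lemma path_edges_snoc:
  assumes "p \<noteq> []" "(last p, j) \<in> parcs G"
  shows "path_edges G (p @ [j]) = insert (last p, j) (path_edges G p)"
proof -
  have "(j, last p) \<notin> parcs G"
    using assms(2) rank_less by (metis not_less_iff_gr_or_eq)
  with assms show ?thesis
    by (auto simp: path_edges_def Defs.vwalk_arcs_snoc)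
qed

text \<open>Once a trek goes down, it cannot turn up again without creating a collider, so the rank
  grows until the end.\<close>

lemma rank_less_last_if_descending:
  assumes "set (vwalk_arcs (y # x # r)) \<subseteq> parcs G \<union> (parcs G)\<inverse>" "distinct (y # x # r)"
    "(y, x) \<in> parcs G" "\<not> has_collider (path_edges G (y # x # r))"
  shows "rank y < rank (last (x # r))"
  using assms
proof (induction r arbitrary: y x)
  case Nil
  then show ?case by (simp add: rank_less)
next
  case (Cons z r)
  have "(x, z) \<in> parcs G"
  proof (rule ccontr)
    assume "(x, z) \<notin> parcs G"
    with Cons.prems(1,3) have "(z, x) \<in> path_edges G (y # x # z # r)" "(y, x) \<in> path_edges G (y # x # z # r)"
      by (auto simp: path_edges_def)
    moreover have "y \<noteq> z" using Cons.prems(2) by auto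
    ultimately show False using Cons.prems(4) by (auto simp: has_collider_def)
  qed
  moreover have "\<not> has_collider (path_edges G (x # z # r))"
    using Cons.prems(4) has_collider_mono path_edges_mono by (metis set_vwalk_arcs_cons)
  ultimately have "rank x < rank (last (z # r))"
    using Cons.prems by (intro Cons.IH) auto
  with rank_less[OF Cons.prems(3)] show ?case by simp
qed

text \<open>The two edges at an inner vertex do not both enter it, so the trek descends from there
  to at least one of its ends. This later shows that an appended endpoint is new.\<close>

lemma rank_less_inner_trek:
  assumes p: "p \<in> treks G i j" and v: "v \<in> set p" "v \<noteq> i" "v \<noteq> j"
  shows "rank v < rank i \<or> rank v < rank j"
proof -
  obtain q r where qr: "p = q @ v # r" using v(1) by (auto simp: in_set_conv_decomp)
  have t: "set (vwalk_arcs p) \<subseteq> parcs G \<union> (parcs G)\<inverse>" "distinct p"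
    "hd p = i" "last p = j" "\<not> has_collider (path_edges G p)"
    using p by (auto simp: treks_iff)
  have ne: "q \<noteq> []" "r \<noteq> []" using qr t(3,4) v by auto
  obtain q' a where q: "q = q' @ [a]" using ne(1) by (metis rev_exhaust)
  obtain b r' where r: "r = b # r'" using ne(2) by (metis list.exhaust)
  \<comment> \<open>\<open>a\<close> and \<open>b\<close> are the neighbours of \<open>v\<close>.
    The half leading to \<open>i\<close> is read backwards, so that both halves start at
    \<open>v\<close>.\<close>
  have p': "p = q' @ [a, v, b] @ r'" "p = (q' @ [a]) @ v # b # r'" "rev p = (rev r' @ [b]) @ v # a # rev q'"
    using qr q r by simp_all
  have sub1: "set (vwalk_arcs (v # b # r')) \<subseteq> set (vwalk_arcs p)"
    unfolding p'(2) by (rule set_vwalk_arcs_append2)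
  have sub2: "set (vwalk_arcs (v # a # rev q')) \<subseteq> set (vwalk_arcs (rev p))"
    unfolding p'(3) by (rule set_vwalk_arcs_append2)
  then have sub2': "(set (vwalk_arcs (v # a # rev q')))\<inverse> \<subseteq> set (vwalk_arcs p)"
    unfolding Defs.set_vwalk_arcs_rev by auto
  have sub3: "path_edges G (v # a # rev q') \<subseteq> path_edges G p"
    using path_edges_mono[OF sub2] by (simp add: path_edges_rev)
  consider "(v, b) \<in> parcs G" | "(v, a) \<in> parcs G"
  proof -
    have False if "(v, b) \<notin> parcs G" "(v, a) \<notin> parcs G"
    proof -
      have "(b, v) \<in> path_edges G p" using that(1) sub1 t(1) by (auto simp: path_edges_def)
      moreover have "(a, v) \<in> path_edges G p" using that(2) sub2' t(1) by (auto simp: path_edges_def)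
      moreover have "a \<noteq> b" using t(2) unfolding p'(1) by auto
      ultimately show False using t(5) by (auto simp: has_collider_def)
    qed
    then show thesis using that by blast
  qed
  then show ?thesis
  proof cases
    case 1
    have "rank v < rank (last (b # r'))"
    proof (rule rank_less_last_if_descending[OF _ _ 1])
      show "set (vwalk_arcs (v # b # r')) \<subseteq> parcs G \<union> (parcs G)\<inverse>"
        using sub1 t(1) by blast
      show "distinct (v # b # r')"
        using t(2) unfolding p'(1) by auto
      show "\<not> has_collider (path_edges G (v # b # r'))"
        using t(5) path_edges_mono[OF sub1] has_collider_mono by blast
    qed
    then show ?thesis using t(4) by (simp add: p'(2))
  next
    case 2
    have "rank v < rank (last (a # rev q'))"
    proof (rule rank_less_last_if_descending[OF _ _ 2])
      show "set (vwalk_arcs (v # a # rev q')) \<subseteq> parcs G \<union> (parcs G)\<inverse>"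
      proof (rule order.trans)
        show "set (vwalk_arcs (v # a # rev q')) \<subseteq> (set (vwalk_arcs p))\<inverse>"
          using sub2 unfolding Defs.set_vwalk_arcs_rev .
        show "(set (vwalk_arcs p))\<inverse> \<subseteq> parcs G \<union> (parcs G)\<inverse>"
          using t(1) by auto
      qed
      show "distinct (v # a # rev q')"
        using t(2) unfolding p'(1) by auto
      show "\<not> has_collider (path_edges G (v # a # rev q'))"
        using t(5) sub3 has_collider_mono by blast
    qed
    moreover have "last (a # rev q') = i"
      using t(3) unfolding p'(1) by (cases q') auto
    ultimately show ?thesis by simp
  qed
qed

text \<open>If the last edge left \<open>j\<close>, the reversed trek would descend from
  \<open>j\<close> to \<open>i\<close>, against the ranks; so it enters \<open>j\<close>.
  Conversely, appending \<open>j\<close> creates neither a repeated vertex nor a collider, because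
  \<open>j\<close> is new.\<close>

lemma snoc_in_treks_iff:
  assumes "i \<noteq> j" "rank i \<le> rank j"
  shows "p \<in> treks G i j \<longleftrightarrow> (\<exists>q x. p = q @ [j] \<and> (x, j) \<in> parcs G \<and> q \<in> treks G i x)" (is "?L \<longleftrightarrow> ?R")
proof
  assume ?L
  then have t: "p \<noteq> []" "set p \<subseteq> pverts G" "set (vwalk_arcs p) \<subseteq> parcs G \<union> (parcs G)\<inverse>" "distinct p"
    "hd p = i" "last p = j" "\<not> has_collider (path_edges G p)"
    by (auto simp: treks_iff)
  obtain q where p: "p = q @ [j]" using t(1,6) by (metis append_butlast_last_id)
  have q: "q \<noteq> []" using p t(5) assms(1) by auto
  let ?x = "last q"
  have sub: "set (vwalk_arcs q) \<subseteq> set (vwalk_arcs p)"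
    unfolding p by (rule set_vwalk_arcs_append1)
  have "(?x, j) \<in> parcs G"
  proof (rule ccontr)
    assume "(?x, j) \<notin> parcs G"
    then have jx: "(j, ?x) \<in> parcs G"
      using t(3) q by (auto simp: p vwalk_arcs_snoc)
    obtain r where r: "q = rev r @ [?x]"
      using q by (metis append_butlast_last_id rev_rev_ident)
    have rev: "rev p = j # ?x # r" by (subst p, subst r) simp
    have "rank j < rank (last (?x # r))"
    proof (rule rank_less_last_if_descending[OF _ _ jx])
      show "set (vwalk_arcs (j # ?x # r)) \<subseteq> parcs G \<union> (parcs G)\<inverse>"
        unfolding rev[symmetric] Defs.set_vwalk_arcs_rev using t(3) by auto
      show "distinct (j # ?x # r)" unfolding rev[symmetric] using t(4) by simp
      show "\<not> has_collider (path_edges G (j # ?x # r))"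
        unfolding rev[symmetric] path_edges_rev by (rule t(7))
    qed
    also have "last (?x # r) = i"
      using t(1,5) rev by (metis last_ConsR last_rev list.distinct(1))
    finally show False using assms(2) by simp
  qed
  moreover have "q \<in> treks G i ?x"
  proof -
    have "\<not> has_collider (path_edges G q)"
      using t(7) path_edges_mono[OF sub] has_collider_mono by blast
    moreover have "set (vwalk_arcs q) \<subseteq> parcs G \<union> (parcs G)\<inverse>"
      using sub t(3) by blast
    ultimately show ?thesis
      using t q by (auto simp: treks_iff p)
  qed
  ultimately show ?R using p by blast
next
  assume ?R
  then obtain q x where p: "p = q @ [j]" and x: "(x, j) \<in> parcs G" and q: "q \<in> treks G i x" by blast
  have t: "q \<noteq> []" "set q \<subseteq> pverts G" "set (vwalk_arcs q) \<subseteq> parcs G \<union> (parcs G)\<inverse>" "distinct q"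
    "hd q = i" "last q = x" "\<not> has_collider (path_edges G q)"
    using q by (auto simp: treks_iff)
  \<comment> \<open>As an inner vertex of \<open>q\<close>, \<open>j\<close> would have smaller rank
    than \<open>i\<close> or \<open>x\<close>; both are excluded.\<close>
  have j: "j \<notin> set q"
    using rank_less_inner_trek[OF q, of j] rank_less[OF x] assms by force
  have "\<not> has_collider (path_edges G (q @ [j]))"
  proof
    assume "has_collider (path_edges G (q @ [j]))"
    then obtain a b k where "a \<noteq> b" and "(a, k) \<in> insert (x, j) (path_edges G q)"
      "(b, k) \<in> insert (x, j) (path_edges G q)"
      using t x by (auto simp: path_edges_snoc has_collider_def)
    moreover have "(c, j) \<notin> path_edges G q" for c
      using j path_edges_in_set(2) by fast
    ultimately have "has_collider (path_edges G q)"
      by (auto simp: has_collider_def)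
    with t(7) show False ..
  qed
  then show ?L
    using t x j arcs_in_verts by (auto simp: treks_iff p vwalk_arcs_snoc)
qed

text \<open>The new edge enters only the new vertex, so the top is unchanged.\<close>

lemma trek_monomial_snoc:
  assumes "p \<noteq> []" "j \<notin> set p" "(last p, j) \<in> parcs G"
  shows "trek_monomial G (p @ [j]) = trek_monomial G p * mVar (Lamvar (last p) j)"
proof -
  have notin: "(last p, j) \<notin> path_edges G p"
    using path_edges_in_set assms(2) by blast
  have "(v \<in> set (p @ [j]) \<and> (\<forall>e\<in>path_edges G (p @ [j]). snd e \<noteq> v)) \<longleftrightarrow>
    (v \<in> set p \<and> (\<forall>e\<in>path_edges G p. snd e \<noteq> v))" for v
    using assms by (auto simp: path_edges_snoc)
  then have "trek_top G (p @ [j]) = trek_top G p"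
    by (simp add: trek_top_def)
  then show ?thesis
    using notin by (simp add: trek_monomial_def path_edges_snoc[OF assms(1,3)] finite_path_edges mult_ac)
qed

section \<open>Recursion for the trek sums\<close>

abbreviation sig :: "'v \<Rightarrow> 'v \<Rightarrow> ('v param, complex) mpoly" where
  "sig \<equiv> apply_commute (trek_sum G)"

lemma sig_eq_sum: "sig i j = (\<Sum>p\<in>treks G i j. trek_monomial G p)"
  by (simp add: trek_sum.rep_eq)

lemma sig_commute: "sig i j = sig j i"
  by (metis case_uprod_simps Upair_inject)

text \<open>A simple path from \<open>i\<close> to itself consists of \<open>i\<close>
  alone.\<close>

lemma sig_self: "i \<in> pverts G \<Longrightarrow> sig i i = mVar (Avar i)"
proof -
  assume "i \<in> pverts G"
  have "p = [i]" if "p \<in> treks G i i" for p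
  proof (cases p)
    case (Cons a q)
    have "a = i" "last (a # q) = i" "a \<notin> set q"
      using that Cons by (auto simp: treks_iff)
    then have "q = []"
      using last_in_set[of q] by (cases "q = []") auto
    with Cons \<open>a = i\<close> show ?thesis by simp
  qed (use that in \<open>auto simp: treks_iff\<close>)
  moreover have "[i] \<in> treks G i i"
    using \<open>i \<in> pverts G\<close> by (auto simp: treks_iff has_collider_def path_edges_def)
  ultimately have "treks G i i = {[i]}" by blast
  moreover have "trek_top G [i] = i" by (auto simp: trek_top_def path_edges_def)
  ultimately show ?thesis
    by (simp add: sig_eq_sum trek_monomial_def) (simp add: path_edges_def)
qed

text \<open>Cut off the last edge of each trek; the families for different parents \<open>x\<close>
  of \<open>j\<close> are disjoint because their treks end differently. From here on, linear
  recursions replace sums over paths.\<close>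

lemma sig_rec:
  assumes "i \<noteq> j" "rank i \<le> rank j"
  shows "sig i j = (\<Sum>x\<in>{x. (x, j) \<in> parcs G}. sig i x * mVar (Lamvar x j))"
proof -
  let ?P = "{x. (x, j) \<in> parcs G}"
  have fin: "finite ?P"
    by (rule finite_subset[OF _ finite_verts]) (use arcs_in_verts in auto)
  have j: "j \<notin> set q" if "q \<in> treks G i x" "(x, j) \<in> parcs G" for q x
    using rank_less_inner_trek[OF that(1), of j] rank_less[OF that(2)] assms by force
  have "sig i j = (\<Sum>p\<in>(\<lambda>q. q @ [j]) ` (\<Union>x\<in>?P. treks G i x). trek_monomial G p)"
    unfolding sig_eq_sum by (rule arg_cong[where f = "sum _"]) (use snoc_in_treks_iff[OF assms] in blast)
  also have "\<dots> = (\<Sum>q\<in>(\<Union>x\<in>?P. treks G i x). trek_monomial G (q @ [j]))"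
    by (subst sum.reindex) (auto simp: inj_on_def)
  also have "\<dots> = (\<Sum>x\<in>?P. \<Sum>q\<in>treks G i x. trek_monomial G (q @ [j]))"
    by (rule sum.UNION_disjoint) (use fin finite_treks in \<open>auto simp: treks_iff\<close>)
  also have "\<dots> = (\<Sum>x\<in>?P. \<Sum>q\<in>treks G i x. trek_monomial G q * mVar (Lamvar x j))"
    using j by (intro sum.cong refl, subst trek_monomial_snoc) (auto simp: treks_iff)
  also have "\<dots> = (\<Sum>x\<in>?P. sig i x * mVar (Lamvar x j))"
    by (simp add: sig_eq_sum sum_distrib_right)
  finally show ?thesis .
qed

end

section \<open>Diagonally dominant systems\<close>

text \<open>The Levy-Desplanques argument: if a nonzero vector is in the kernel, the row of a
  coordinate of largest norm contradicts dominance.\<close>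

lemma diag_dominant_solvable:
  fixes T :: "nat \<Rightarrow> nat \<Rightarrow> 'a::real_normed_field"
  assumes dom: "\<And>i. i < n \<Longrightarrow> (\<Sum>k\<in>{..<n} - {i}. norm (T i k)) < norm (T i i)"
  shows "\<exists>x. \<forall>i<n. (\<Sum>k<n. T i k * x k) = t i"
proof -
  define A where "A = mat n n (\<lambda>(i, k). T i k)"
  have A: "A \<in> carrier_mat n n" by (simp add: A_def)
  have mult: "(A *\<^sub>v v) $ i = (\<Sum>k<n. T i k * v $ k)" if "i < n" "v \<in> carrier_vec n" for v i
    using that by (auto simp: A_def scalar_prod_def lessThan_atLeast0)
  have "det A \<noteq> 0"
  proof
    assume "det A = 0"
    then obtain v where v: "v \<in> carrier_vec n" "v \<noteq> 0\<^sub>v n" "A *\<^sub>v v = 0\<^sub>v n"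
      using det_0_iff_vec_prod_zero_field[OF A] by auto
    let ?N = "(\<lambda>i. norm (v $ i)) ` {..<n}"
    from v(1,2) obtain i0 where i0: "i0 < n" "v $ i0 \<noteq> 0"
      by (metis carrier_vecD eq_vecI index_zero_vec)
    obtain i where i: "i < n" "norm (v $ i) = Max ?N"
      using Max_in[of ?N] i0(1) by fastforce
    have max: "norm (v $ k) \<le> norm (v $ i)" if "k < n" for k
      unfolding i(2) using that by (intro Max_ge) auto
    have pos: "norm (v $ i) > 0"
      using max[OF i0(1)] i0(2) by (metis less_le_trans zero_less_norm_iff)
    have "0 = (\<Sum>k<n. T i k * v $ k)"
      using mult[OF i(1) v(1)] v(3) i(1) by simp
    also have "\<dots> = T i i * v $ i + (\<Sum>k\<in>{..<n} - {i}. T i k * v $ k)"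
      using i(1) by (intro sum.remove) auto
    finally have "norm (T i i * v $ i) = norm (\<Sum>k\<in>{..<n} - {i}. T i k * v $ k)"
      by (metis add.inverse_inverse add_eq_0_iff norm_minus_cancel)
    also have "\<dots> \<le> (\<Sum>k\<in>{..<n} - {i}. norm (T i k) * norm (v $ i))"
      by (intro order.trans[OF norm_sum] sum_mono) (auto simp: norm_mult intro!: mult_left_mono max)
    also have "\<dots> < norm (T i i) * norm (v $ i)"
      unfolding sum_distrib_right[symmetric] using dom[OF i(1)] pos by (intro mult_strict_right_mono)
    finally show False by (simp add: norm_mult)
  qed
  then obtain B where B: "B \<in> carrier_mat n n" "A * B = 1\<^sub>m n"
    using det_non_zero_imp_unit[OF A] by (auto simp: Units_def ring_mat_def)
  let ?x = "B *\<^sub>v vec n t"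
  have "A *\<^sub>v ?x = (A * B) *\<^sub>v vec n t"
    by (rule assoc_mult_mat_vec[symmetric]) (use A B in auto)
  also have "\<dots> = vec n t" by (simp add: B)
  finally have "A *\<^sub>v ?x = vec n t" .
  moreover have "?x \<in> carrier_vec n" using B by simp
  ultimately have "\<forall>i<n. (\<Sum>k<n. T i k * ?x $ k) = t i"
    using mult by (metis index_vec)
  then show ?thesis by blast
qed

text \<open>The bound on the diagonal depends only on the correction \<open>c\<close>, since the
  off-diagonal entries of \<open>S\<close> are confined to the unit disc. It can thus be fixed
  before \<open>S\<close> is chosen.\<close>

lemma diag_dominant_if_large_diag:
  fixes S c :: "nat \<Rightarrow> nat \<Rightarrow> 'a::real_normed_field"
  assumes "i < n" "norm (S i i) > (\<Sum>i<n. \<Sum>m<n. 1 + norm (c i m))"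
    and "\<And>m. m < n \<Longrightarrow> m \<noteq> i \<Longrightarrow> norm (S i m) \<le> 1"
  shows "(\<Sum>m\<in>{..<n} - {i}. norm (S i m - c i m)) < norm (S i i - c i i)"
proof -
  have "(\<Sum>m\<in>{..<n} - {i}. norm (S i m - c i m)) \<le> (\<Sum>m\<in>{..<n} - {i}. 1 + norm (c i m))"
    using assms(3) by (intro sum_mono order.trans[OF norm_triangle_ineq4]) auto
  \<comment> \<open>The term split off here pays for passing from \<open>S i i\<close> to
    \<open>S i i - c i i\<close> at the end.\<close>
  also have "\<dots> = (\<Sum>m<n. 1 + norm (c i m)) - (1 + norm (c i i))"
    using assms(1) by (subst sum.remove[of "{..<n}" i]) auto
  also have "(\<Sum>m<n. 1 + norm (c i m)) \<le> (\<Sum>i<n. \<Sum>m<n. 1 + norm (c i m))"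
    using assms(1) by (intro member_le_sum[of i "{..<n}" "\<lambda>i. \<Sum>m<n. 1 + norm (c i m)"]) (auto intro: sum_nonneg)
  also have "\<dots> < norm (S i i)" by fact
  also have "norm (S i i) \<le> norm (S i i - c i i) + norm (c i i)"
    by (metis diff_add_cancel norm_triangle_ineq)
  finally show ?thesis by simp
qed

text \<open>Eliminating \<open>\<beta>\<close> leaves, for each \<open>j\<close>, a square linear system for the \<open>\<alpha> _ j\<close> whose matrix is
  the Schur complement \<open>S - P\<^sup>T P\<close> restricted to the indices below \<open>j\<close>.\<close>

lemma ex_edge_weights:
  fixes S :: "nat \<Rightarrow> nat \<Rightarrow> complex" and P :: "'e \<Rightarrow> nat \<Rightarrow> complex" and k :: "'e \<Rightarrow> nat"
  assumes E: "finite E" and P: "\<And>e i. e \<in> E \<Longrightarrow> i < k e \<Longrightarrow> P e i = 0"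
    and dom: "\<And>i. i < n \<Longrightarrow> (\<Sum>m\<in>{..<n} - {i}. norm (S i m - (\<Sum>e\<in>E. P e i * P e m)))
      < norm (S i i - (\<Sum>e\<in>E. P e i * P e i))"
  shows "\<exists>\<alpha> \<beta>. \<forall>j<n.
    (\<forall>i<j. S i j = (\<Sum>m<j. S i m * \<alpha> m j) + (\<Sum>e\<in>{e \<in> E. k e \<le> j}. P e i * \<beta> e j)) \<and>
    (\<forall>e\<in>E. P e j = (\<Sum>m<j. P e m * \<alpha> m j) + (if k e \<le> j then \<beta> e j else 0))"
proof -
  define T where "T i m = S i m - (\<Sum>e\<in>E. P e i * P e m)" for i m
  have "\<exists>x. \<forall>i<j. (\<Sum>m<j. T i m * x m) = T i j" if "j < n" for j
  proof (rule diag_dominant_solvable)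
    fix i assume "i < j"
    \<comment> \<open>Dominance passes to the leading block, where fewer off-diagonal terms
      remain.\<close>
    have "(\<Sum>m\<in>{..<j} - {i}. norm (T i m)) \<le> (\<Sum>m\<in>{..<n} - {i}. norm (T i m))"
      using that by (intro sum_mono2) auto
    also have "\<dots> < norm (T i i)"
      unfolding T_def using \<open>i < j\<close> that by (intro dom) simp
    finally show "(\<Sum>m\<in>{..<j} - {i}. norm (T i m)) < norm (T i i)" .
  qed
  then obtain x where x: "(\<Sum>m<j. T i m * x j m) = T i j" if "j < n" "i < j" for i j
    by metis
  \<comment> \<open>Forced by the second equation when \<open>k e \<le> j\<close>.\<close>
  define \<beta> where "\<beta> e j = P e j - (\<Sum>m<j. P e m * x j m)" for e j
  have "S i j = (\<Sum>m<j. S i m * x j m) + (\<Sum>e\<in>{e \<in> E. k e \<le> j}. P e i * \<beta> e j)"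
    if "j < n" "i < j" for i j
  proof -
    \<comment> \<open>If \<open>j < k e\<close>, then also \<open>i < k e\<close>, so
      \<open>P e i = 0\<close> and the sum may run over all of \<open>E\<close>.\<close>
    have "(\<Sum>e\<in>{e \<in> E. k e \<le> j}. P e i * \<beta> e j) = (\<Sum>e\<in>E. P e i * \<beta> e j)"
    proof (rule sum.mono_neutral_left)
      show "\<forall>e\<in>E - {e \<in> E. k e \<le> j}. P e i * \<beta> e j = 0"
        using that(2) by (auto intro!: P)
    qed (use E in auto)
    also have "\<dots> = (\<Sum>e\<in>E. P e i * P e j) - (\<Sum>e\<in>E. \<Sum>m<j. P e i * P e m * x j m)"
      by (simp add: \<beta>_def right_diff_distrib sum_subtractf sum_distrib_left mult.assoc)
    also have "(\<Sum>e\<in>E. \<Sum>m<j. P e i * P e m * x j m) = (\<Sum>m<j. (\<Sum>e\<in>E. P e i * P e m) * x j m)"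
      by (subst sum.swap) (simp add: sum_distrib_right)
    finally have "(\<Sum>e\<in>{e \<in> E. k e \<le> j}. P e i * \<beta> e j) = (\<Sum>e\<in>E. P e i * P e j) -
      (\<Sum>m<j. (\<Sum>e\<in>E. P e i * P e m) * x j m)" .
    note \<beta>_sum = this
    have "S i j = T i j + (\<Sum>e\<in>E. P e i * P e j)"
      by (simp add: T_def)
    also have "T i j = (\<Sum>m<j. S i m * x j m) - (\<Sum>m<j. (\<Sum>e\<in>E. P e i * P e m) * x j m)"
      using x[OF that] by (simp add: T_def left_diff_distrib sum_subtractf)
    finally show ?thesis
      by (simp add: \<beta>_sum)
  qed
  \<comment> \<open>For \<open>j < k e\<close> everything in this equation is zero.\<close>
  moreover have "P e j = (\<Sum>m<j. P e m * x j m) + (if k e \<le> j then \<beta> e j else 0)" if "e \<in> E" for e j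
    using P[OF that] by (auto simp: \<beta>_def)
  ultimately show ?thesis
    by (intro exI[of _ "\<lambda>m j. x j m"] exI[of _ \<beta>]) blast
qed

section \<open>Covariances of the Schubert network\<close>

lemma finite_support: "finite (support n w)"
  by (rule finite_subset[of _ "{..<n} \<times> {..<n}"]) (auto simp: support_def)

text \<open>All columns are ranked above all rows, so that the trek rule can always be unfolded at the
  column end.\<close>

definition vertex_rank :: "nat \<Rightarrow> vertex \<Rightarrow> nat" where
  "vertex_rank n = case_vertex Suc (\<lambda>k. Suc (n + k)) (\<lambda>_ _. 0)"

lemma vertex_rank_simps [simp]:
  "vertex_rank n (Row k) = Suc k" "vertex_rank n (Col k) = Suc (n + k)" "vertex_rank n (Entry k l) = 0"
  by (simp_all add: vertex_rank_def)

lemma ranked_dag_schubert_dag: "ranked_dag (schubert_dag n w) (vertex_rank n)"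
proof
  have "finite {Entry i j | i j. (i, j) \<in> support n w}"
    by (rule finite_subset[of _ "case_prod Entry ` support n w"]) (auto simp: finite_support)
  then show "finite (pverts (schubert_dag n w))"
    by (simp add: schubert_dag_def observed_def)
  show "parcs (schubert_dag n w) \<subseteq> pverts (schubert_dag n w) \<times> pverts (schubert_dag n w)"
    by (fastforce simp: schubert_dag_def observed_def support_def)
  show "vertex_rank n x < vertex_rank n y" if "(x, y) \<in> parcs (schubert_dag n w)" for x y
    using that by (auto simp: schubert_dag_def)
qed

section \<open>Trek sums at given parameter values\<close>

abbreviation entry :: "nat \<times> nat \<Rightarrow> vertex" where
  "entry \<equiv> case_prod Entry"

text \<open>The covariance of \<open>u\<close> and \<open>v\<close> in the Gaussian network, with
  complex parameters allowed.\<close>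

definition cov :: "nat \<Rightarrow> complex mat \<Rightarrow> (vertex param \<Rightarrow> complex) \<Rightarrow> vertex \<Rightarrow> vertex \<Rightarrow> complex" where
  "cov n w \<theta> u v = mpoly_eval id \<theta> (apply_commute (trek_sum (schubert_dag n w)) u v)"

lemma cov_commute: "cov n w \<theta> u v = cov n w \<theta> v u"
  unfolding cov_def by (subst ranked_dag.sig_commute[OF ranked_dag_schubert_dag]) simp

text \<open>Treks are simple paths, so the parameter at \<open>Avar u\<close> is the full variance
  of \<open>u\<close>. This is what allows the diagonal to be prescribed directly.\<close>

lemma cov_self: "u \<in> pverts (schubert_dag n w) \<Longrightarrow> cov n w \<theta> u u = \<theta> (Avar u)"
  by (simp add: cov_def ranked_dag.sig_self[OF ranked_dag_schubert_dag] mpoly_eval_mVar comm_ring_hom_id)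

lemma cov_rec:
  assumes "u \<noteq> v" "vertex_rank n u \<le> vertex_rank n v"
  shows "cov n w \<theta> u v = (\<Sum>x\<in>{x. (x, v) \<in> parcs (schubert_dag n w)}. cov n w \<theta> u x * \<theta> (Lamvar x v))"
proof -
  interpret e: comm_ring_hom "mpoly_eval id \<theta> :: (vertex param, complex) mpoly \<Rightarrow> complex"
    by (intro comm_ring_hom_mpoly_eval comm_ring_hom_id)
  show ?thesis
    unfolding cov_def ranked_dag.sig_rec[OF ranked_dag_schubert_dag assms]
    by (simp add: e.hom_sum e.hom_mult mpoly_eval_mVar comm_ring_hom_id)
qed

lemma sum_image_Un:
  assumes "finite A" "finite B" "inj_on f A" "inj_on g B" "f ` A \<inter> g ` B = {}"
  shows "sum h (f ` A \<union> g ` B) = (\<Sum>x\<in>A. h (f x)) + (\<Sum>x\<in>B. h (g x))"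
  using assms by (simp add: sum.union_disjoint sum.reindex)

text \<open>The parents of a row are the earlier rows and the entries lying in a row up to
  \<open>j\<close>. The rank hypothesis restricts \<open>u\<close> to entries and earlier
  rows.\<close>

lemma cov_Row:
  assumes "u \<noteq> Row j" "vertex_rank n u \<le> Suc j" "j < n"
  shows "cov n w \<theta> u (Row j) = (\<Sum>k<j. cov n w \<theta> u (Row k) * \<theta> (Lamvar (Row k) (Row j))) +
    (\<Sum>e\<in>{e \<in> support n w. fst e \<le> j}. cov n w \<theta> u (entry e) * \<theta> (Lamvar (entry e) (Row j)))"
proof -
  have "{x. (x, Row j) \<in> parcs (schubert_dag n w)} =
      Row ` {..<j} \<union> entry ` {e \<in> support n w. fst e \<le> j}"
    using assms(3) by (auto simp: schubert_dag_def image_iff)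
  then show ?thesis
    using assms
    by (subst cov_rec) (auto intro!: sum_image_Un simp: finite_support inj_on_def)
qed

text \<open>Unlike in \<open>cov_Row\<close>, here \<open>u\<close> may be any row of the matrix,
  since columns are ranked last.\<close>

lemma cov_Col:
  assumes "u \<noteq> Col j" "vertex_rank n u \<le> Suc (n + j)" "j < n"
  shows "cov n w \<theta> u (Col j) = (\<Sum>k<j. cov n w \<theta> u (Col k) * \<theta> (Lamvar (Col k) (Col j))) +
    (\<Sum>e\<in>{e \<in> support n w. snd e \<le> j}. cov n w \<theta> u (entry e) * \<theta> (Lamvar (entry e) (Col j)))"
proof -
  have "{x. (x, Col j) \<in> parcs (schubert_dag n w)} =
      Col ` {..<j} \<union> entry ` {e \<in> support n w. snd e \<le> j}"
    using assms(3) by (auto simp: schubert_dag_def image_iff)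
  then show ?thesis
    using assms
    by (subst cov_rec) (auto intro!: sum_image_Un simp: finite_support inj_on_def)
qed

section \<open>Covariances with the entries\<close>

lemma cov_entry_self: "e \<in> support n w \<Longrightarrow> cov n w \<theta> (entry e) (entry e) = \<theta> (Avar (entry e))"
  by (rule cov_self) (cases e, auto simp: schubert_dag_def)

text \<open>Entries are sources, so the recursion ends in an empty sum.\<close>

lemma cov_entry_entry: "e \<noteq> e' \<Longrightarrow> cov n w \<theta> (entry e) (entry e') = 0"
  by (subst cov_rec) (auto simp: schubert_dag_def split: prod.splits)

lemma sum_cov_entry:
  assumes "e \<in> support n w"
  shows "(\<Sum>e'\<in>{e \<in> support n w. Q e}. cov n w \<theta> (entry e) (entry e') * g e') =
    (if Q e then \<theta> (Avar (entry e)) * g e else 0)"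
proof -
  have "(\<Sum>e'\<in>{e \<in> support n w. Q e}. cov n w \<theta> (entry e) (entry e') * g e') =
      (\<Sum>e'\<in>{e \<in> support n w. Q e}. if e' = e then \<theta> (Avar (entry e)) * g e else 0)"
  proof (intro sum.cong refl)
    fix e' assume "e' \<in> {e \<in> support n w. Q e}"
    show "cov n w \<theta> (entry e) (entry e') * g e' = (if e' = e then \<theta> (Avar (entry e)) * g e else 0)"
    proof (cases "e' = e")
      case True
      then show ?thesis using cov_entry_self[OF assms, of \<theta>] by simp
    next
      case False
      then show ?thesis using cov_entry_entry[of e e' n w \<theta>] by simp
    qed
  qed
  then show ?thesis
    using assms by (simp add: finite_support)
qed

lemma cov_entry_Row:
  assumes "e \<in> support n w" "j < n"
  shows "cov n w \<theta> (entry e) (Row j) =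
    (\<Sum>k<j. cov n w \<theta> (entry e) (Row k) * \<theta> (Lamvar (Row k) (Row j))) +
    (if fst e \<le> j then \<theta> (Avar (entry e)) * \<theta> (Lamvar (entry e) (Row j)) else 0)"
  using assms by (subst cov_Row) (auto simp: sum_cov_entry split: prod.splits)

lemma cov_entry_Col:
  assumes "e \<in> support n w" "j < n"
  shows "cov n w \<theta> (entry e) (Col j) =
    (\<Sum>k<j. cov n w \<theta> (entry e) (Col k) * \<theta> (Lamvar (Col k) (Col j))) +
    (if snd e \<le> j then \<theta> (Avar (entry e)) * \<theta> (Lamvar (entry e) (Col j)) else 0)"
  using assms by (subst cov_Col) (auto simp: sum_cov_entry split: prod.splits)

text \<open>Rows and columns are connected only through entries. Both sides satisfy the same
  recursion in the column index \<open>j\<close>.\<close>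

lemma cov_Row_Col:
  assumes a: "\<And>e. e \<in> support n w \<Longrightarrow> \<theta> (Avar (entry e)) \<noteq> 0" and "i < n" "j < n"
  shows "cov n w \<theta> (Row i) (Col j) = (\<Sum>e\<in>support n w.
    cov n w \<theta> (entry e) (Row i) * (cov n w \<theta> (entry e) (Col j) / \<theta> (Avar (entry e))))"
  using assms(3)
proof (induction j rule: less_induct)
  case (less j)
  let ?S = "support n w" and ?c = "cov n w \<theta>"
  let ?l = "\<lambda>k. \<theta> (Lamvar (Col k) (Col j))"
  have "?c (Row i) (Col j) = (\<Sum>k<j. ?c (Row i) (Col k) * ?l k) +
      (\<Sum>e\<in>{e \<in> ?S. snd e \<le> j}. ?c (Row i) (entry e) * \<theta> (Lamvar (entry e) (Col j)))"
    using assms(2) less.prems by (intro cov_Col) auto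
  also have "(\<Sum>k<j. ?c (Row i) (Col k) * ?l k) =
      (\<Sum>k<j. \<Sum>e\<in>?S. ?c (entry e) (Row i) * (?c (entry e) (Col k) / \<theta> (Avar (entry e))) * ?l k)"
    using less by (simp add: sum_distrib_right)
  also have "\<dots> = (\<Sum>e\<in>?S. ?c (entry e) (Row i) * (\<Sum>k<j. ?c (entry e) (Col k) * ?l k) / \<theta> (Avar (entry e)))"
    by (subst sum.swap) (simp add: sum_distrib_left sum_divide_distrib mult_ac)
  also have "(\<Sum>e\<in>{e \<in> ?S. snd e \<le> j}. ?c (Row i) (entry e) * \<theta> (Lamvar (entry e) (Col j))) =
      (\<Sum>e\<in>?S. ?c (entry e) (Row i) * (if snd e \<le> j then \<theta> (Lamvar (entry e) (Col j)) else 0))"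
    by (rule sum.mono_neutral_cong_left) (auto simp: finite_support cov_commute)
  also have "(\<Sum>e\<in>?S. ?c (entry e) (Row i) * (\<Sum>k<j. ?c (entry e) (Col k) * ?l k) / \<theta> (Avar (entry e))) + \<dots>
      = (\<Sum>e\<in>?S. ?c (entry e) (Row i) * (?c (entry e) (Col j) / \<theta> (Avar (entry e))))"
    unfolding sum.distrib[symmetric]
    by (intro sum.cong refl) (use a less.prems in \<open>auto simp: cov_entry_Col[of _ n w j] field_simps\<close>)
  finally show ?case .
qed

text \<open>Only the ones of \<open>w\<close> contribute. The result has the shape of
  \<open>cov_Row_Col\<close>, with rows of \<open>b\<close> and \<open>c\<close> in place of the
  covariances with the entries.\<close>

lemma index_mat_orbit:
  assumes w: "partial_permutation_mat n w" and "b \<in> carrier_mat n n" "c \<in> carrier_mat n n" "i < n" "j < n"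
  shows "(transpose_mat b * w * c) $$ (i, j) = (\<Sum>e\<in>support n w. b $$ (fst e, i) * c $$ (snd e, j))"
proof -
  have wc: "w \<in> carrier_mat n n" and w01: "k < n \<Longrightarrow> l < n \<Longrightarrow> w $$ (k, l) = 0 \<or> w $$ (k, l) = 1" for k l
    using w by (auto simp: partial_permutation_mat_def)
  have "(transpose_mat b * w * c) $$ (i, j) = (\<Sum>k<n. \<Sum>l<n. b $$ (k, i) * w $$ (k, l) * c $$ (l, j))"
    using assms wc by (simp add: scalar_prod_def lessThan_atLeast0 sum_distrib_left mult.assoc)
  also have "\<dots> = (\<Sum>(k, l)\<in>{..<n} \<times> {..<n}. b $$ (k, i) * w $$ (k, l) * c $$ (l, j))"
    by (simp add: sum.cartesian_product)
  also have "\<dots> = (\<Sum>(k, l)\<in>support n w. b $$ (k, i) * c $$ (l, j))"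
  proof (rule sum.mono_neutral_cong_right)
    show "\<forall>e\<in>{..<n} \<times> {..<n} - support n w.
      (case e of (k, l) \<Rightarrow> b $$ (k, i) * w $$ (k, l) * c $$ (l, j)) = 0"
      using w01 by (fastforce simp: support_def)
  qed (auto simp: support_def)
  finally show ?thesis by (simp add: case_prod_unfold)
qed

section \<open>Realizing covariance matrices\<close>

text \<open>\<open>C\<close> and the prescribed \<open>S\<close>, \<open>P\<close> obey the same
  triangular recursion, which determines everything from the diagonal: first the covariances with
  entries, then the rest by induction on the larger index. It is stated abstractly to serve rows and
  columns alike; entries are normalized to variance one.\<close>

lemma covariance_eqI:
  fixes C :: "'v \<Rightarrow> 'v \<Rightarrow> complex" and R :: "nat \<Rightarrow> 'v" and ent :: "'e \<Rightarrow> 'v"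
  assumes C_commute: "\<And>u v. C u v = C v u" and S_commute: "\<And>i j. S i j = S j i"
    and C_R: "\<And>i j. i < j \<Longrightarrow> j < n \<Longrightarrow> C (R i) (R j) =
      (\<Sum>m<j. C (R i) (R m) * \<alpha> m j) + (\<Sum>e\<in>{e \<in> E. k e \<le> j}. C (R i) (ent e) * \<beta> e j)"
    and C_ent: "\<And>e j. e \<in> E \<Longrightarrow> j < n \<Longrightarrow> C (ent e) (R j) =
      (\<Sum>m<j. C (ent e) (R m) * \<alpha> m j) + (if k e \<le> j then \<beta> e j else 0)"
    and C_self: "\<And>i. i < n \<Longrightarrow> C (R i) (R i) = S i i"
    and S: "\<And>i j. i < j \<Longrightarrow> j < n \<Longrightarrow>
      S i j = (\<Sum>m<j. S i m * \<alpha> m j) + (\<Sum>e\<in>{e \<in> E. k e \<le> j}. P e i * \<beta> e j)"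
    and P: "\<And>e j. e \<in> E \<Longrightarrow> j < n \<Longrightarrow>
      P e j = (\<Sum>m<j. P e m * \<alpha> m j) + (if k e \<le> j then \<beta> e j else 0)"
  shows "\<And>e j. e \<in> E \<Longrightarrow> j < n \<Longrightarrow> C (ent e) (R j) = P e j"
    and "\<And>i j. i < n \<Longrightarrow> j < n \<Longrightarrow> C (R i) (R j) = S i j"
proof -
  show ent: "C (ent e) (R j) = P e j" if "e \<in> E" "j < n" for e j
    using that(2)
  proof (induction j rule: less_induct)
    case (less j)
    then have "(\<Sum>m<j. C (ent e) (R m) * \<alpha> m j) = (\<Sum>m<j. P e m * \<alpha> m j)"
      by (intro sum.cong) auto
    then show ?case
      using C_ent[OF that(1) less.prems] P[OF that(1) less.prems] by simp
  qed
  have le: "C (R i) (R j) = S i j" if "i \<le> j" "j < n" for i j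
    using that
  proof (induction j arbitrary: i rule: less_induct)
    case (less j)
    show ?case
    proof (cases "i = j")
      case True
      then show ?thesis using C_self less.prems by simp
    next
      case False
      then have ij: "i < j" using less.prems by simp
      \<comment> \<open>For \<open>m < i\<close> the roles are exchanged by symmetry, so that the
        induction hypothesis applies at \<open>i < j\<close>.\<close>
      have "C (R i) (R m) = S i m" if "m < j" for m
      proof (cases "i \<le> m")
        case True
        then show ?thesis using less that by simp
      next
        case False
        then have "C (R m) (R i) = S m i"
          using less.IH[of i m] ij less.prems by simp
        then show ?thesis
          by (simp only: C_commute[of "R i" "R m"] S_commute[of i m])
      qed
      moreover have "C (R i) (ent e) = P e i" if "e \<in> E" for e
        using ent[OF that, of i] ij less.prems by (simp only: C_commute[of "R i" "ent e"])
      ultimately show ?thesis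
        using C_R[OF ij less.prems(2)] S[OF ij less.prems(2)] by simp
    qed
  qed
  show "C (R i) (R j) = S i j" if "i < n" "j < n" for i j
  proof (cases "i \<le> j")
    case False
    then have "C (R j) (R i) = S j i" using le that by simp
    then show ?thesis by (simp only: C_commute[of "R i" "R j"] S_commute[of i j])
  qed (use le that in auto)
qed

text \<open>The row-row and column-column blocks are realized separately by
  \<open>ex_edge_weights\<close>, with rows of \<open>b\<close> and \<open>c\<close> as covariances
  with the entries. The row-column block then comes out right by \<open>cov_Row_Col\<close>.\<close>

lemma ex_parameters:
  assumes w: "partial_permutation_mat n w" and b: "b \<in> borel_group n" and c: "c \<in> borel_group n"
    and \<sigma>: "\<And>i j. i < n \<Longrightarrow> j < n \<Longrightarrow> \<sigma> (Upair (Row i) (Col j)) = (transpose_mat b * w * c) $$ (i, j)"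
    and dom_Row: "\<And>i. i < n \<Longrightarrow> (\<Sum>m\<in>{..<n} - {i}. norm (\<sigma> (Upair (Row i) (Row m)) -
        (\<Sum>e\<in>support n w. b $$ (fst e, i) * b $$ (fst e, m)))) <
      norm (\<sigma> (Upair (Row i) (Row i)) - (\<Sum>e\<in>support n w. b $$ (fst e, i) * b $$ (fst e, i)))"
    and dom_Col: "\<And>i. i < n \<Longrightarrow> (\<Sum>m\<in>{..<n} - {i}. norm (\<sigma> (Upair (Col i) (Col m)) -
        (\<Sum>e\<in>support n w. c $$ (snd e, i) * c $$ (snd e, m)))) <
      norm (\<sigma> (Upair (Col i) (Col i)) - (\<Sum>e\<in>support n w. c $$ (snd e, i) * c $$ (snd e, i)))"
  shows "\<exists>\<theta>. \<forall>u\<in>observed n. \<forall>v\<in>observed n. cov n w \<theta> u v = \<sigma> (Upair u v)"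
proof -
  let ?E = "support n w"
  have lt: "fst e < n" "snd e < n" if "e \<in> ?E" for e
    using that by (auto simp: support_def)
  have tri: "g $$ (i, j) = 0" if "g \<in> borel_group n" "i < n" "j < i" for g i j
    using that by (auto simp: borel_group_def upper_triangular_def)
  have "\<exists>\<alpha> \<beta>. \<forall>j<n. (\<forall>i<j. \<sigma> (Upair (Row i) (Row j)) = (\<Sum>m<j. \<sigma> (Upair (Row i) (Row m)) * \<alpha> m j) +
      (\<Sum>e\<in>{e \<in> ?E. fst e \<le> j}. b $$ (fst e, i) * \<beta> e j)) \<and>
    (\<forall>e\<in>?E. b $$ (fst e, j) = (\<Sum>m<j. b $$ (fst e, m) * \<alpha> m j) + (if fst e \<le> j then \<beta> e j else 0))"
  proof (rule ex_edge_weights[OF finite_support])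
    show "b $$ (fst e, i) = 0" if "e \<in> ?E" "i < fst e" for e i
      using that by (intro tri b lt)
  qed (fact dom_Row)
  then obtain \<alpha> \<beta> where row: "\<And>j. j < n \<Longrightarrow> (\<forall>i<j. \<sigma> (Upair (Row i) (Row j)) = (\<Sum>m<j. \<sigma> (Upair (Row i) (Row m)) * \<alpha> m j) +
      (\<Sum>e\<in>{e \<in> ?E. fst e \<le> j}. b $$ (fst e, i) * \<beta> e j)) \<and>
    (\<forall>e\<in>?E. b $$ (fst e, j) = (\<Sum>m<j. b $$ (fst e, m) * \<alpha> m j) + (if fst e \<le> j then \<beta> e j else 0))"
    by blast
  have "\<exists>\<alpha> \<beta>. \<forall>j<n. (\<forall>i<j. \<sigma> (Upair (Col i) (Col j)) = (\<Sum>m<j. \<sigma> (Upair (Col i) (Col m)) * \<alpha> m j) +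
      (\<Sum>e\<in>{e \<in> ?E. snd e \<le> j}. c $$ (snd e, i) * \<beta> e j)) \<and>
    (\<forall>e\<in>?E. c $$ (snd e, j) = (\<Sum>m<j. c $$ (snd e, m) * \<alpha> m j) + (if snd e \<le> j then \<beta> e j else 0))"
  proof (rule ex_edge_weights[OF finite_support])
    show "c $$ (snd e, i) = 0" if "e \<in> ?E" "i < snd e" for e i
      using that by (intro tri c lt)
  qed (fact dom_Col)
  then obtain \<alpha>' \<beta>' where col: "\<And>j. j < n \<Longrightarrow> (\<forall>i<j. \<sigma> (Upair (Col i) (Col j)) = (\<Sum>m<j. \<sigma> (Upair (Col i) (Col m)) * \<alpha>' m j) +
      (\<Sum>e\<in>{e \<in> ?E. snd e \<le> j}. c $$ (snd e, i) * \<beta>' e j)) \<and>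
    (\<forall>e\<in>?E. c $$ (snd e, j) = (\<Sum>m<j. c $$ (snd e, m) * \<alpha>' m j) + (if snd e \<le> j then \<beta>' e j else 0))"
    by blast
  \<comment> \<open>Variance one at the entries removes the divisors in \<open>cov_Row_Col\<close>;
    the observed vertices receive the prescribed diagonal.\<close>
  define avar where "avar v = (case v of Entry _ _ \<Rightarrow> 1 | _ \<Rightarrow> \<sigma> (Upair v v))" for v
  \<comment> \<open>The default \<open>0\<close> is taken only at pairs that are not arcs.\<close>
  define lam where "lam u v = (case v of
      Row j \<Rightarrow> (case u of Row m \<Rightarrow> \<alpha> m j | Entry k l \<Rightarrow> \<beta> (k, l) j | _ \<Rightarrow> 0)
    | Col j \<Rightarrow> (case u of Col m \<Rightarrow> \<alpha>' m j | Entry k l \<Rightarrow> \<beta>' (k, l) j | _ \<Rightarrow> 0)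
    | _ \<Rightarrow> 0)" for u v
  define \<theta> where "\<theta> = case_param avar lam"
  have \<theta>: "\<theta> (Avar (entry e)) = 1" "\<theta> (Avar (Row i)) = \<sigma> (Upair (Row i) (Row i))"
    "\<theta> (Avar (Col i)) = \<sigma> (Upair (Col i) (Col i))"
    "\<theta> (Lamvar (Row i) (Row j)) = \<alpha> i j" "\<theta> (Lamvar (Col i) (Col j)) = \<alpha>' i j"
    "\<theta> (Lamvar (entry e) (Row j)) = \<beta> e j" "\<theta> (Lamvar (entry e) (Col j)) = \<beta>' e j" for e i j
    by (simp_all add: \<theta>_def avar_def lam_def split: prod.split)
  have verts: "Row i \<in> pverts (schubert_dag n w)" "Col i \<in> pverts (schubert_dag n w)" if "i < n" for i
    using that by (auto simp: schubert_dag_def observed_def)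
  have Upair_commute: "Upair u v = Upair v u" for u v :: vertex
    by simp
  have Row_S: "\<sigma> (Upair (Row i) (Row j)) = (\<Sum>m<j. \<sigma> (Upair (Row i) (Row m)) * \<alpha> m j) +
      (\<Sum>e\<in>{e \<in> ?E. fst e \<le> j}. b $$ (fst e, i) * \<beta> e j)" if "i < j" "j < n" for i j
    using row[OF that(2)] that(1) by blast
  have Row_P: "b $$ (fst e, j) = (\<Sum>m<j. b $$ (fst e, m) * \<alpha> m j) + (if fst e \<le> j then \<beta> e j else 0)"
    if "e \<in> ?E" "j < n" for e j
    using row[OF that(2)] that(1) by blast
  have Row_C: "cov n w \<theta> (Row i) (Row j) = (\<Sum>m<j. cov n w \<theta> (Row i) (Row m) * \<alpha> m j) +
      (\<Sum>e\<in>{e \<in> ?E. fst e \<le> j}. cov n w \<theta> (Row i) (entry e) * \<beta> e j)" if "i < j" "j < n" for i j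
    by (subst cov_Row) (use that in \<open>simp_all add: \<theta>\<close>)
  have Row_entry: "cov n w \<theta> (entry e) (Row j) =
      (\<Sum>m<j. cov n w \<theta> (entry e) (Row m) * \<alpha> m j) + (if fst e \<le> j then \<beta> e j else 0)"
    if "e \<in> ?E" "j < n" for e j
    by (subst cov_entry_Row[OF that]) (simp add: \<theta>)
  have Row_self: "cov n w \<theta> (Row i) (Row i) = \<sigma> (Upair (Row i) (Row i))" if "i < n" for i
    by (simp add: cov_self verts that \<theta>)
  note Row = covariance_eqI[where C = "cov n w \<theta>" and R = Row and ent = entry and E = ?E and k = fst
      and n = n and \<alpha> = \<alpha> and \<beta> = \<beta> and P = "\<lambda>e j. b $$ (fst e, j)"
      and S = "\<lambda>i j. \<sigma> (Upair (Row i) (Row j))",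
      OF cov_commute arg_cong[where f = \<sigma>, OF Upair_commute] Row_C Row_entry Row_self Row_S Row_P]
  have Col_S: "\<sigma> (Upair (Col i) (Col j)) = (\<Sum>m<j. \<sigma> (Upair (Col i) (Col m)) * \<alpha>' m j) +
      (\<Sum>e\<in>{e \<in> ?E. snd e \<le> j}. c $$ (snd e, i) * \<beta>' e j)" if "i < j" "j < n" for i j
    using col[OF that(2)] that(1) by blast
  have Col_P: "c $$ (snd e, j) = (\<Sum>m<j. c $$ (snd e, m) * \<alpha>' m j) + (if snd e \<le> j then \<beta>' e j else 0)"
    if "e \<in> ?E" "j < n" for e j
    using col[OF that(2)] that(1) by blast
  have Col_C: "cov n w \<theta> (Col i) (Col j) = (\<Sum>m<j. cov n w \<theta> (Col i) (Col m) * \<alpha>' m j) +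
      (\<Sum>e\<in>{e \<in> ?E. snd e \<le> j}. cov n w \<theta> (Col i) (entry e) * \<beta>' e j)" if "i < j" "j < n" for i j
    by (subst cov_Col) (use that in \<open>simp_all add: \<theta>\<close>)
  have Col_entry: "cov n w \<theta> (entry e) (Col j) =
      (\<Sum>m<j. cov n w \<theta> (entry e) (Col m) * \<alpha>' m j) + (if snd e \<le> j then \<beta>' e j else 0)"
    if "e \<in> ?E" "j < n" for e j
    by (subst cov_entry_Col[OF that]) (simp add: \<theta>)
  have Col_self: "cov n w \<theta> (Col i) (Col i) = \<sigma> (Upair (Col i) (Col i))" if "i < n" for i
    by (simp add: cov_self verts that \<theta>)
  note Col = covariance_eqI[where C = "cov n w \<theta>" and R = Col and ent = entry and E = ?E and k = snd
      and n = n and \<alpha> = \<alpha>' and \<beta> = \<beta>' and P = "\<lambda>e j. c $$ (snd e, j)"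
      and S = "\<lambda>i j. \<sigma> (Upair (Col i) (Col j))",
      OF cov_commute arg_cong[where f = \<sigma>, OF Upair_commute] Col_C Col_entry Col_self Col_S Col_P]
  have RC: "cov n w \<theta> (Row i) (Col j) = \<sigma> (Upair (Row i) (Col j))" if "i < n" "j < n" for i j
  proof -
    have "cov n w \<theta> (Row i) (Col j) = (\<Sum>e\<in>?E. b $$ (fst e, i) * c $$ (snd e, j))"
      using that by (subst cov_Row_Col) (simp_all add: \<theta> Row Col)
    also have "\<dots> = (transpose_mat b * w * c) $$ (i, j)"
      using w b c that by (intro index_mat_orbit[symmetric]) (auto simp: borel_group_def)
    finally show ?thesis using \<sigma>[OF that] by simp
  qed
  have "cov n w \<theta> (Col j) (Row i) = \<sigma> (Upair (Col j) (Row i))" if "i < n" "j < n" for i j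
    using RC[OF that] by (simp only: cov_commute[of n w \<theta> "Col j"] Upair_commute[of "Col j"])
  then show ?thesis
    using Row(2) Col(2) RC by (intro exI[of _ \<theta>]) (auto simp: observed_def)
qed

section \<open>From parameters to the orbit\<close>

lemma invertible_upper_triangular:
  fixes A :: "'a::field mat"
  assumes A: "A \<in> carrier_mat n n" and "upper_triangular A" and "\<And>i. i < n \<Longrightarrow> A $$ (i, i) \<noteq> 0"
  shows "invertible_mat A"
proof -
  have "det A \<noteq> 0"
    using assms upper_triangular_imp_det_eq_0_iff[OF A] by (auto simp: diag_mat_def)
  then obtain B where "B \<in> carrier_mat n n" "A * B = 1\<^sub>m n" "B * A = 1\<^sub>m n"
    using det_non_zero_imp_unit[OF A] by (auto simp: Units_def ring_mat_def)
  then show ?thesis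
    using A by (auto simp: invertible_mat_def inverts_mat_def intro!: exI[of _ B])
qed

text \<open>The rows that are not prescribed are taken from the identity matrix, so the diagonal is
  nonzero throughout. Injectivity of \<open>k\<close> ensures that no row is prescribed
  twice.\<close>

lemma ex_borel_with_rows:
  assumes inj: "inj_on k E" and k: "k ` E \<subseteq> {..<n}"
    and x: "\<And>e i. e \<in> E \<Longrightarrow> i < k e \<Longrightarrow> x e i = 0" "\<And>e. e \<in> E \<Longrightarrow> x e (k e) \<noteq> 0"
  shows "\<exists>b\<in>borel_group n. \<forall>e\<in>E. \<forall>i<n. b $$ (k e, i) = x e i"
proof -
  define b where "b = mat n n (\<lambda>(r, i). if r \<in> k ` E then x (the_inv_into E k r) i else if r = i then 1 else 0)"
  have row: "b $$ (k e, i) = x e i" if "e \<in> E" "i < n" for e i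
    using that k by (auto simp: b_def the_inv_into_f_f[OF inj])
  have b: "b \<in> carrier_mat n n" by (simp add: b_def)
  have diag: "b $$ (r, r) \<noteq> 0" if "r < n" for r
  proof (cases "r \<in> k ` E")
    case True
    then show ?thesis using row x(2) that by auto
  qed (use that in \<open>simp add: b_def\<close>)
  have "b $$ (r, i) = 0" if "r < n" "i < r" for r i
  proof (cases "r \<in> k ` E")
    case True
    then show ?thesis using row x(1) that by auto
  qed (use that in \<open>simp add: b_def\<close>)
  then have "upper_triangular b" using b by (auto simp: upper_triangular_def)
  with b diag have "b \<in> borel_group n"
    by (auto simp: borel_group_def intro: invertible_upper_triangular)
  with row show ?thesis by blast
qed

lemma cov_in_orbit:
  assumes w: "partial_permutation_mat n w" and nz: "\<And>x. \<theta> x \<noteq> 0"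
  shows "\<exists>b\<in>borel_group n. \<exists>c\<in>borel_group n. \<forall>i<n. \<forall>j<n.
    cov n w \<theta> (Row i) (Col j) = (transpose_mat b * w * c) $$ (i, j)"
proof -
  let ?E = "support n w"
  \<comment> \<open>A partial permutation matrix has at most one entry in each row and
    column.\<close>
  have fst: "inj_on fst ?E" "fst ` ?E \<subseteq> {..<n}" and snd: "inj_on snd ?E" "snd ` ?E \<subseteq> {..<n}"
    using w by (auto simp: inj_on_def support_def partial_permutation_mat_def)
  have Row0: "cov n w \<theta> (entry e) (Row i) = 0" if "e \<in> ?E" "i < fst e" for e i
    using that(2)
  proof (induction i rule: less_induct)
    case (less i)
    moreover have "i < n" using less.prems that(1) fst(2) by force
    ultimately show ?case
      using that(1) by (subst cov_entry_Row) (auto intro!: sum.neutral)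
  qed
  have Col0: "cov n w \<theta> (entry e) (Col i) = 0" if "e \<in> ?E" "i < snd e" for e i
    using that(2)
  proof (induction i rule: less_induct)
    case (less i)
    moreover have "i < n" using less.prems that(1) snd(2) by force
    ultimately show ?case
      using that(1) by (subst cov_entry_Col) (auto intro!: sum.neutral)
  qed
  have "\<exists>b\<in>borel_group n. \<forall>e\<in>?E. \<forall>i<n. b $$ (fst e, i) = cov n w \<theta> (entry e) (Row i)"
  proof (rule ex_borel_with_rows[OF fst Row0])
    \<comment> \<open>At the row of the entry itself all earlier terms vanish, which leaves a
      product of two nonzero parameters.\<close>
    show "cov n w \<theta> (entry e) (Row (fst e)) \<noteq> 0" if "e \<in> ?E" for e
      using that fst(2) nz Row0 by (subst cov_entry_Row) auto
  qed
  then obtain b where b: "b \<in> borel_group n"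
    "\<And>e i. e \<in> ?E \<Longrightarrow> i < n \<Longrightarrow> b $$ (fst e, i) = cov n w \<theta> (entry e) (Row i)" by blast
  \<comment> \<open>The division by the variance of the entry is absorbed into
    \<open>c\<close>.\<close>
  have "\<exists>c\<in>borel_group n. \<forall>e\<in>?E. \<forall>i<n. c $$ (snd e, i) = cov n w \<theta> (entry e) (Col i) / \<theta> (Avar (entry e))"
  proof (rule ex_borel_with_rows[OF snd])
    show "cov n w \<theta> (entry e) (Col (snd e)) / \<theta> (Avar (entry e)) \<noteq> 0" if "e \<in> ?E" for e
      using that snd(2) nz Col0 by (subst cov_entry_Col) auto
  qed (simp add: Col0)
  then obtain c where c: "c \<in> borel_group n"
    "\<And>e i. e \<in> ?E \<Longrightarrow> i < n \<Longrightarrow> c $$ (snd e, i) = cov n w \<theta> (entry e) (Col i) / \<theta> (Avar (entry e))" by blast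
  have "cov n w \<theta> (Row i) (Col j) = (transpose_mat b * w * c) $$ (i, j)" if "i < n" "j < n" for i j
    using w b(1) c(1) that
    by (subst index_mat_orbit) (auto simp: borel_group_def cov_Row_Col nz b(2) c(2))
  with b(1) c(1) show ?thesis by blast
qed

section \<open>Comparison of the ideals\<close>

lemma mpoly_ring_simps [simp]:
  "carrier (mpoly_ring X) = {p. mvars p \<subseteq> X}" "\<zero>\<^bsub>mpoly_ring X\<^esub> = 0" "\<one>\<^bsub>mpoly_ring X\<^esub> = 1"
  "p \<oplus>\<^bsub>mpoly_ring X\<^esub> q = p + q" "p \<otimes>\<^bsub>mpoly_ring X\<^esub> q = p * q"
  by (simp_all add: mpoly_ring_def)

lemma ideal_mpoly_ring_sum:
  assumes I: "ideal I (mpoly_ring X)" and "\<And>i. i \<in> K \<Longrightarrow> h i \<in> I"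
  shows "sum h K \<in> I"
  using assms(2)
proof (induction K rule: infinite_finite_induct)
  case (insert a K)
  then show ?case
    using additive_subgroup.a_closed[OF ideal.axioms(1)[OF I], of "h a" "sum h K"] by simp
qed (use additive_subgroup.zero_closed[OF ideal.axioms(1)[OF I]] in simp_all)

section \<open>Both ideals as vanishing conditions\<close>

lemma hidden_network_ideal_eq:
  assumes "Obs \<subseteq> pverts G"
  shows "hidden_network_ideal G Obs = {f \<in> carrier (sigma_ring Obs). trek_hom G f = 0}"
proof -
  have "carrier (sigma_ring Obs) \<subseteq> carrier (sigma_ring (pverts G))"
    using assms by (fastforce simp: sigma_ring_def)
  then show ?thesis
    by (auto simp: hidden_network_ideal_def network_ideal_def a_kernel_def' param_ring_def)
qed

lemma ideal_hidden_network_ideal: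
  assumes "Obs \<subseteq> pverts G"
  shows "ideal (hidden_network_ideal G Obs) (sigma_ring Obs)"
proof -
  interpret h: comm_ring_hom "trek_hom G"
    unfolding trek_hom_def by (intro comm_ring_hom_mpoly_eval comm_ring_hom_mConst)
  have ring: "ring (mpoly_ring X :: ('x, complex) mpoly ring)" for X :: "'x set"
    by (intro cring.axioms cring_mpoly_ring)
  \<comment> \<open>The kernel sees only the zero of the target. In the ring of all variables,
    membership of the images is immediate.\<close>
  have "ring_hom_ring (sigma_ring Obs) (mpoly_ring UNIV) (trek_hom G)"
    by (intro ring_hom_ringI) (simp_all add: sigma_ring_def ring h.hom_mult h.hom_add)
  then have "ideal (a_kernel (sigma_ring Obs) (mpoly_ring UNIV) (trek_hom G)) (sigma_ring Obs)"
    by (rule ring_hom_ring.kernel_is_ideal)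
  then show ?thesis
    by (simp add: hidden_network_ideal_eq[OF assms] a_kernel_def')
qed

text \<open>The usual Galois connection; it reduces membership in the Schubert ideal to vanishing on
  the orbit itself.\<close>

lemma vanishing_ideal_zariski_closure:
  assumes "S \<subseteq> carrier_mat n n"
  shows "vanishing_ideal n (zariski_closure n S) = vanishing_ideal n S"
proof
  have "S \<subseteq> zariski_closure n S"
    using assms by (auto simp: zariski_closure_def zero_locus_def vanishing_ideal_def)
  then show "vanishing_ideal n (zariski_closure n S) \<subseteq> vanishing_ideal n S"
    unfolding vanishing_ideal_def by blast
  show "vanishing_ideal n S \<subseteq> vanishing_ideal n (zariski_closure n S)"
    by (auto simp: zariski_closure_def zero_locus_def vanishing_ideal_def)
qed

lemma schubert_ideal_eq:
  "schubert_ideal n w =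
    vanishing_ideal n {transpose_mat b * w * c | b c. b \<in> borel_group n \<and> c \<in> borel_group n}"
  unfolding schubert_ideal_def matrix_schubert_variety_def
  by (rule vanishing_ideal_zariski_closure) (auto simp: borel_group_def)

text \<open>The index of a row-column variable. Its range contains all row and column numbers; the
  bound \<open>n\<close> enters through the variables of the polynomials.\<close>

definition rc_pair :: "nat \<times> nat \<Rightarrow> vertex uprod" where
  "rc_pair = (\<lambda>(i, j). Upair (Row i) (Col j))"

lemma inj_rc_pair: "inj rc_pair"
  by (auto simp: inj_def rc_pair_def)

lemma coordinate_embedding_eq: "coordinate_embedding = mpoly_eval mConst (\<lambda>x. mVar (rc_pair x))"
  by (simp add: coordinate_embedding_def rc_pair_def case_prod_unfold)

lemma mpoly_eval_coordinate_embedding: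
  "mpoly_eval id h (coordinate_embedding g) = mpoly_eval id (\<lambda>x. h (rc_pair x)) g"
  unfolding coordinate_embedding_eq
  by (simp add: mpoly_eval_mpoly_eval mpoly_eval_mVar comm_ring_hom_id)

lemma mvars_coordinate_embedding: "mvars (coordinate_embedding g) \<subseteq> rc_pair ` mvars g"
  unfolding coordinate_embedding_eq
  by (intro order.trans[OF mvars_mpoly_eval]) (auto simp: mvars_mVar)

text \<open>Rename the variables back along the inverse of \<open>rc_pair\<close>.\<close>

lemma ex_coordinate_embedding:
  assumes "mvars p \<subseteq> rc_pair ` A"
  shows "\<exists>g. mvars g \<subseteq> A \<and> coordinate_embedding g = p"
proof -
  define g :: "(nat \<times> nat, complex) mpoly" where "g = mpoly_eval mConst (\<lambda>u. mVar (inv_into UNIV rc_pair u)) p"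
  have "mvars g \<subseteq> inv_into UNIV rc_pair ` mvars p"
    unfolding g_def by (intro order.trans[OF mvars_mpoly_eval]) (auto simp: mvars_mVar)
  also have "\<dots> \<subseteq> A"
    using assms by (auto simp: inj_rc_pair)
  finally have "mvars g \<subseteq> A" .
  have "coordinate_embedding g = mpoly_eval mConst (\<lambda>u. mVar (rc_pair (inv_into UNIV rc_pair u))) p"
    unfolding g_def coordinate_embedding_eq
    by (simp add: mpoly_eval_mpoly_eval mpoly_eval_mVar comm_ring_hom_mConst)
  also have "\<dots> = mpoly_eval mConst mVar p"
    by (rule mpoly_eval_cong) (use assms in \<open>auto simp: f_inv_into_f[where f = rc_pair]\<close>)
  finally show ?thesis
    using \<open>mvars g \<subseteq> A\<close> by (auto simp: mpoly_eval_mConst_mVar)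
qed

text \<open>Values of the image of \<open>f\<close> are values of \<open>f\<close> at
  covariances.\<close>

lemma mpoly_eval_trek_hom:
  "mpoly_eval id \<theta> (trek_hom (schubert_dag n w) f) =
    mpoly_eval id (\<lambda>x. mpoly_eval id \<theta> (case_uprod (trek_sum (schubert_dag n w)) x)) f"
  unfolding trek_hom_def by (rule mpoly_eval_mpoly_eval) (rule comm_ring_hom_id)

theorem theorem7p5:
  fixes n :: nat and w :: "complex mat"
  assumes "partial_permutation_mat n w"
  shows "Idl\<^bsub>sigma_ring (observed n)\<^esub> (coordinate_embedding ` schubert_ideal n w)
         = hidden_network_ideal (schubert_dag n w) (observed n)"
proof (rule antisym)
  let ?G = "schubert_dag n w" and ?R = "sigma_ring (observed n)" and ?A = "{..<n} \<times> {..<n}"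
  have obs: "observed n \<subseteq> pverts ?G"
    by (auto simp: schubert_dag_def)
  have rc: "rc_pair ` ?A \<subseteq> {Upair u v | u v. u \<in> observed n \<and> v \<in> observed n}"
    by (auto simp: rc_pair_def observed_def)
  interpret R: ring ?R
    unfolding sigma_ring_def by (intro cring.axioms cring_mpoly_ring)
  have gens: "coordinate_embedding ` schubert_ideal n w \<subseteq> carrier ?R"
  proof (rule image_subsetI)
    fix g assume "g \<in> schubert_ideal n w"
    then have "rc_pair ` mvars g \<subseteq> rc_pair ` ?A"
      by (intro image_mono) (simp add: schubert_ideal_eq vanishing_ideal_def coordinate_ring_def)
    with mvars_coordinate_embedding[of g] rc show "coordinate_embedding g \<in> carrier ?R"
      unfolding sigma_ring_def mpoly_ring_simps mem_Collect_eq by (meson order.trans)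
  qed
  show "Idl\<^bsub>?R\<^esub> (coordinate_embedding ` schubert_ideal n w) \<subseteq> hidden_network_ideal ?G (observed n)"
  proof (rule R.genideal_minimal[OF ideal_hidden_network_ideal[OF obs]], rule image_subsetI)
    fix g assume g: "g \<in> schubert_ideal n w"
    have "trek_hom ?G (coordinate_embedding g) = 0"
    \<comment> \<open>Nonzero parameters suffice for the zero test, and they are what puts the
      row-column block into the orbit.\<close>
    proof (rule mpoly_eq_0_if_vanishing[of "\<lambda>_. - {0}"])
      fix \<theta> :: "vertex param \<Rightarrow> complex" assume "\<And>x. \<theta> x \<in> - {0}"
      then obtain b c where bc: "b \<in> borel_group n" "c \<in> borel_group n" and
        cov: "\<And>i j. i < n \<Longrightarrow> j < n \<Longrightarrow> cov n w \<theta> (Row i) (Col j) = (transpose_mat b * w * c) $$ (i, j)"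
        using cov_in_orbit[OF assms, of \<theta>] by auto
      have "mpoly_eval id \<theta> (trek_hom ?G (coordinate_embedding g)) =
          mpoly_eval id (\<lambda>(i, j). cov n w \<theta> (Row i) (Col j)) g"
        unfolding mpoly_eval_trek_hom mpoly_eval_coordinate_embedding
        by (simp add: rc_pair_def case_prod_unfold cov_def)
      also have "\<dots> = mpoly_eval id (($$) (transpose_mat b * w * c)) g"
        using g by (intro mpoly_eval_cong)
          (auto simp: schubert_ideal_eq vanishing_ideal_def coordinate_ring_def cov dest!: subsetD)
      also have "\<dots> = 0"
        using g bc by (auto simp: schubert_ideal_eq vanishing_ideal_def)
      finally show "mpoly_eval id \<theta> (trek_hom ?G (coordinate_embedding g)) = 0" .
    qed (simp add: infinite_UNIV_char_0 Compl_eq_Diff_UNIV)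
    then show "coordinate_embedding g \<in> hidden_network_ideal ?G (observed n)"
      using gens g by (auto simp: hidden_network_ideal_eq[OF obs])
  qed
  show "hidden_network_ideal ?G (observed n) \<subseteq> Idl\<^bsub>?R\<^esub> (coordinate_embedding ` schubert_ideal n w)"
    (is "_ \<subseteq> ?I")
  proof
    fix f assume "f \<in> hidden_network_ideal ?G (observed n)"
    then have f: "mvars f \<subseteq> {Upair u v | u v. u \<in> observed n \<and> v \<in> observed n}" "trek_hom ?G f = 0"
      by (auto simp: hidden_network_ideal_eq[OF obs] sigma_ring_def)
    have I: "ideal ?I ?R" by (rule R.genideal_ideal[OF gens])
    \<comment> \<open>The monomials of \<open>f\<close> in the row-row and column-column variables;
      their coefficients will be shown to come from the Schubert ideal.\<close>
    let ?M = "monomial_restrict (- range rc_pair) ` Poly_Mapping.keys f"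
    have "partial_coeff (range rc_pair) f \<mu> * Poly_Mapping.single \<mu> 1 \<in> ?I" if \<mu>: "\<mu> \<in> ?M" for \<mu>
    proof -
      let ?p = "partial_coeff (range rc_pair) f \<mu>"
      have "mvars ?p \<subseteq> rc_pair ` ?A"
      proof
        fix x assume "x \<in> mvars ?p"
        then have "x \<in> mvars f" "x \<in> range rc_pair"
          using mvars_partial_coeff[of "range rc_pair" f \<mu>] by auto
        moreover from \<open>x \<in> range rc_pair\<close> obtain i j where "x = rc_pair (i, j)"
          by auto
        moreover obtain u v where "x = Upair u v" "u \<in> observed n" "v \<in> observed n"
          using subsetD[OF f(1) \<open>x \<in> mvars f\<close>] by blast
        ultimately have "i < n" "j < n"
          by (auto simp: rc_pair_def observed_def)
        with \<open>x = rc_pair (i, j)\<close> show "x \<in> rc_pair ` ?A" by blast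
      qed
      then obtain g where g: "mvars g \<subseteq> ?A" "coordinate_embedding g = ?p"
        using ex_coordinate_embedding by blast
      have "mpoly_eval id (($$) (transpose_mat b * w * c)) g = 0"
        if bc: "b \<in> borel_group n" "c \<in> borel_group n" for b c
      proof -
        \<comment> \<open>\<open>?h\<close> reads the orbit point as values of the row-column
          variables.\<close>
        let ?E = "support n w" and ?h = "\<lambda>x. (transpose_mat b * w * c) $$ inv_into UNIV rc_pair x"
        define cR where "cR i m = (\<Sum>e\<in>?E. b $$ (fst e, i) * b $$ (fst e, m))" for i m
        define cC where "cC i m = (\<Sum>e\<in>?E. c $$ (snd e, i) * c $$ (snd e, m))" for i m
        define N where "N = (\<Sum>i<n. \<Sum>m<n. 1 + norm (cR i m)) + (\<Sum>i<n. \<Sum>m<n. 1 + norm (cC i m))"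
        \<comment> \<open>Off-diagonal variables stay in the unit interval, while diagonal ones
          exceed \<open>N\<close>, which covers the corrections of both blocks. Both ranges are
          infinite, as \<open>partial_coeff_vanishing\<close> demands.\<close>
        define A where "A x = (of_real :: real \<Rightarrow> complex) `
          (if proper_uprod x then {0..1} else {N<..})" for x :: "vertex uprod"
        have NR: "(\<Sum>i<n. \<Sum>m<n. 1 + norm (cR i m)) \<le> N" "(\<Sum>i<n. \<Sum>m<n. 1 + norm (cC i m)) \<le> N"
          unfolding N_def by (simp_all add: sum_nonneg)
        then have N0: "0 \<le> N"
          by (meson add_nonneg_nonneg norm_ge_zero order.trans sum_nonneg zero_le_one)
        have "mpoly_eval id ?h ?p = 0"
        proof (rule partial_coeff_vanishing[OF _ _ \<mu>])
          show "infinite (A x)" for x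
            unfolding A_def by (subst finite_image_iff) (auto simp: inj_on_def infinite_Icc infinite_Ioi)
          fix \<sigma> assume \<sigma>: "\<And>x. x \<in> range rc_pair \<Longrightarrow> \<sigma> x = ?h x" "\<And>x. x \<notin> range rc_pair \<Longrightarrow> \<sigma> x \<in> A x"
          have notin: "Upair (Row i) (Row m) \<notin> range rc_pair" "Upair (Col i) (Col m) \<notin> range rc_pair" for i m
            by (auto simp: rc_pair_def)
          have small: "norm (\<sigma> (Upair u v)) \<le> 1" if "Upair u v \<notin> range rc_pair" "u \<noteq> v" for u v
            using \<sigma>(2)[OF that(1)] that(2) by (auto simp: A_def)
          have large: "norm (\<sigma> (Upair u u)) > N" if "Upair u u \<notin> range rc_pair" for u
            using \<sigma>(2)[OF that] N0 by (auto simp: A_def)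
          have "\<exists>\<theta>. \<forall>u\<in>observed n. \<forall>v\<in>observed n. cov n w \<theta> u v = \<sigma> (Upair u v)"
          proof (rule ex_parameters[OF assms bc])
            show "\<sigma> (Upair (Row i) (Col j)) = (transpose_mat b * w * c) $$ (i, j)" for i j
              using \<sigma>(1)[of "rc_pair (i, j)"] by (simp add: inj_rc_pair) (simp add: rc_pair_def)
            show "(\<Sum>m\<in>{..<n} - {i}. norm (\<sigma> (Upair (Row i) (Row m)) - (\<Sum>e\<in>?E. b $$ (fst e, i) * b $$ (fst e, m)))) <
              norm (\<sigma> (Upair (Row i) (Row i)) - (\<Sum>e\<in>?E. b $$ (fst e, i) * b $$ (fst e, i)))" if "i < n" for i
              unfolding cR_def[symmetric]
            proof (rule diag_dominant_if_large_diag[OF that])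
              show "(\<Sum>i<n. \<Sum>m<n. 1 + norm (cR i m)) < norm (\<sigma> (Upair (Row i) (Row i)))"
                using NR(1) large[OF notin(1), of i] by simp
            qed (use small notin in auto)
            show "(\<Sum>m\<in>{..<n} - {i}. norm (\<sigma> (Upair (Col i) (Col m)) - (\<Sum>e\<in>?E. c $$ (snd e, i) * c $$ (snd e, m)))) <
              norm (\<sigma> (Upair (Col i) (Col i)) - (\<Sum>e\<in>?E. c $$ (snd e, i) * c $$ (snd e, i)))" if "i < n" for i
              unfolding cC_def[symmetric]
            proof (rule diag_dominant_if_large_diag[OF that])
              show "(\<Sum>i<n. \<Sum>m<n. 1 + norm (cC i m)) < norm (\<sigma> (Upair (Col i) (Col i)))"
                using NR(2) large[OF notin(2), of i] by simp
            qed (use small notin in auto)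
          qed
          then obtain \<theta> where \<theta>: "\<And>u v. u \<in> observed n \<Longrightarrow> v \<in> observed n \<Longrightarrow> cov n w \<theta> u v = \<sigma> (Upair u v)"
            by blast
          \<comment> \<open>On observed pairs \<sigma> consists of covariances, so this is a value
            of the trek image of \<open>f\<close>, which is zero.\<close>
          have "mpoly_eval id \<sigma> f =
              mpoly_eval id (\<lambda>x. mpoly_eval id \<theta> (case_uprod (trek_sum ?G) x)) f"
            using f(1) \<theta> by (intro mpoly_eval_cong) (fastforce simp: cov_def)
          also have "\<dots> = mpoly_eval id \<theta> (trek_hom ?G f)"
            by (rule mpoly_eval_trek_hom[symmetric])
          finally show "mpoly_eval id \<sigma> f = 0"
            by (simp add: f(2) mpoly_eval_def)
        qed
        then show ?thesis
          unfolding g(2)[symmetric] mpoly_eval_coordinate_embedding by (simp add: inj_rc_pair)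
      qed
      then have "g \<in> schubert_ideal n w"
        using g(1) by (auto simp: schubert_ideal_eq vanishing_ideal_def coordinate_ring_def)
      then have "coordinate_embedding g \<in> ?I"
        by (intro subsetD[OF R.genideal_self[OF gens]] imageI)
      then have p: "?p \<in> ?I"
        by (simp only: g(2))
      \<comment> \<open>The outer monomial lies in the ring, so multiplying by it stays in the
        ideal.\<close>
      have "mvars (Poly_Mapping.single \<mu> (1 :: complex)) \<subseteq> mvars f"
        using \<mu> by (auto simp: mvars_def keys_monomial_restrict)
      then have "Poly_Mapping.single \<mu> 1 \<in> carrier ?R"
        using f(1) unfolding sigma_ring_def mpoly_ring_simps mem_Collect_eq by (rule order.trans)
      from ideal.I_r_closed[OF I p this] show ?thesis
        by (simp only: sigma_ring_def mpoly_ring_simps)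
    qed
    then have "(\<Sum>\<mu>\<in>?M. partial_coeff (range rc_pair) f \<mu> * Poly_Mapping.single \<mu> 1) \<in> ?I"
      using I unfolding sigma_ring_def by (intro ideal_mpoly_ring_sum)
    then show "f \<in> ?I"
      using partial_coeff_expansion[of f "range rc_pair"] by simp
  qed
qed

end
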